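(* If $x:M^n\rightarrow\mathbb{R}^{n+1}$ ($n\geq 3$) is an L-isotropic hypersurface with $\lambda>0$, then $x$ has at least three distinct nonvanishing principal curvatures.
   Context: Let $x:M^n\to\mathbb{R}^{n+1}$ be an oriented immersed hypersurface with unit normal $\xi:M^n\to\mathbb{S}^n$, without umbilic points and with nonvanishing principal curvatures (this is part of the definition of L-isotropic). Let $\{e_1,\dots,e_n\}$ be a local frame of unit principal vectors, orthonormal for $dx\cdot dx$, with $e_i(\xi)=-k_ie_i(x)$, $k_i\neq 0$ the principal curvatures. Put $r_i=1/k_i$, $r=\frac1n\sum_i r_i$, $\rho=\sqrt{\sum_i(r-r_i)^2}>0$. Let $III=d\xi\cdot d\xi$ be the third fundamental form. The Laguerre metric is $g=\rho^2\,III$; the vector fields $E_i=\rho^{-1}r_ie_i$ form a $g$-orthonormal frame, with dual coframe $\omega_i$. In this frame, the Laguerre form is $\mathbb{C}=\sum_iC_i\omega_i$ with $C_i=-\rho^{-2}r_i\{e_i(r)-(r-r_i)e_i(\log\rho)\}$, and the Laguerre tensor is $\mathbb{L}=\sum_{ij}L_{ij}\omega_i\otimes\omega_j$ with $L_{ij}=\rho^{-2}\{\mathrm{Hess}_{ij}(\log\rho)_{III}-r_ir_je_i(\log\rho)e_j(\log\rho)+\tfrac12(|\nabla_{III}\log\rho|^2-1)\delta_{ij}\}$, where Hessian (components in the $III$-orthonormal frame $r_ie_i$) and gradient are taken with respect to $III$. $x$ is L-isotropic if $\mathbb{C}=0$ and $L_{ij}=\lambda\delta_{ij}$ for a constant $\lambda\in\mathbb{R}$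 (all eigenvalues of $\mathbb{L}$ equal to the same constant $\lambda$). *)

theory Defs
  imports "HOL-Analysis.Analysis"
begin

section \<open>Smooth maps and manifolds\<close>

primrec Ck_on :: "nat \<Rightarrow> ('a::real_normed_vector \<Rightarrow> 'b::real_normed_vector) \<Rightarrow> 'a set \<Rightarrow> bool" where
  "Ck_on 0 f U \<longleftrightarrow> continuous_on U f"
| "Ck_on (Suc k) f U \<longleftrightarrow> (\<forall>u\<in>U. f differentiable (at u)) \<and>
     (\<forall>v. Ck_on k (\<lambda>u. frechet_derivative f (at u) v) U)"

text \<open>Only meant for open sets \<open>U\<close>: derivatives are taken at full neighbourhoods.\<close>

definition smooth_on :: "('a::real_normed_vector \<Rightarrow> 'b::real_normed_vector) \<Rightarrow> 'a set \<Rightarrow> bool" where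
  "smooth_on f U \<longleftrightarrow> (\<forall>k. Ck_on k f U)"

text \<open>A chart is a domain \<open>U\<close> together with a map \<open>\<phi>\<close>, of which only the values on \<open>U\<close> matter.\<close>

type_synonym ('p, 'n) chart = "'p set \<times> ('p \<Rightarrow> real^'n)"

definition chart_image :: "('p, 'n::finite) chart \<Rightarrow> (real^'n) set" where
  "chart_image c = snd c ` fst c"

definition in_chart :: "('p, 'n::finite) chart \<Rightarrow> ('p \<Rightarrow> 'b) \<Rightarrow> real^'n \<Rightarrow> 'b" where
  "in_chart c f = f \<circ> inv_into (fst c) (snd c)"

text \<open>An \<open>n\<close>-dimensional smooth manifold, where \<open>n = CARD('n)\<close>. The Hausdorff and
  second countability axioms are supplied by the type classes of the ambient type of points.\<close>

definition smooth_manifold ::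
    "'p::{t2_space, second_countable_topology} set \<Rightarrow> ('p, 'n::finite) chart set \<Rightarrow> bool" where
  "smooth_manifold M A \<longleftrightarrow>
     M = (\<Union>c\<in>A. fst c) \<and>
     (\<forall>c\<in>A. openin (top_of_set M) (fst c) \<and> open (chart_image c) \<and>
        homeomorphism (fst c) (chart_image c) (snd c) (inv_into (fst c) (snd c))) \<and>
     (\<forall>c\<in>A. \<forall>d\<in>A. smooth_on (in_chart c (snd d)) (snd c ` (fst c \<inter> fst d)))"

section \<open>Riemannian metrics in coordinates\<close>

definition partial :: "'n::finite \<Rightarrow> (real^'n \<Rightarrow> real) \<Rightarrow> real^'n \<Rightarrow> real" where
  "partial i f u = frechet_derivative f (at u) (axis i 1)"

text \<open>A metric is given by its Gram matrix \<open>G u\<close> in the coordinate basis.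
  \<open>christoffel G u k i j\<close> is the symbol with upper index \<open>k\<close> and lower indices \<open>i\<close>, \<open>j\<close> of the Levi-Civita connection.\<close>

definition christoffel ::
    "(real^'n \<Rightarrow> real^'n^'n) \<Rightarrow> real^'n \<Rightarrow> 'n::finite \<Rightarrow> 'n \<Rightarrow> 'n \<Rightarrow> real" where
  "christoffel G u k i j = (1/2) * (\<Sum>l\<in>UNIV. matrix_inv (G u) $ k $ l *
     (partial i (\<lambda>w. G w $ j $ l) u + partial j (\<lambda>w. G w $ i $ l) u
        - partial l (\<lambda>w. G w $ i $ j) u))"

definition hessian ::
    "(real^'n \<Rightarrow> real^'n^'n) \<Rightarrow> (real^'n \<Rightarrow> real) \<Rightarrow> real^'n \<Rightarrow> real^'n \<Rightarrow> real^'n::finite \<Rightarrow> real" where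
  "hessian G f u v w = (\<Sum>i\<in>UNIV. \<Sum>j\<in>UNIV. v $ i * w $ j *
     (partial i (partial j f) u - (\<Sum>k\<in>UNIV. christoffel G u k i j * partial k f u)))"

definition gradient ::
    "(real^'n \<Rightarrow> real^'n^'n) \<Rightarrow> (real^'n \<Rightarrow> real) \<Rightarrow> real^'n \<Rightarrow> real^'n::finite" where
  "gradient G f u = matrix_inv (G u) *v (\<chi> i. partial i f u)"

definition gradient_norm_sq ::
    "(real^'n \<Rightarrow> real^'n^'n) \<Rightarrow> (real^'n \<Rightarrow> real) \<Rightarrow> real^'n::finite \<Rightarrow> real" where
  "gradient_norm_sq G f u = gradient G f u \<bullet> (G u *v gradient G f u)"

section \<open>Hypersurfaces in local coordinates\<close>

text \<open>In this section \<open>y\<close> and \<open>\<nu>\<close> are the immersion and its unit normal, read in a chart with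
  image \<open>D\<close>. Tangent vectors are given by their coordinates, so that the tangent vector \<open>v\<close> at \<open>u\<close>
  corresponds to the vector \<open>frechet_derivative y (at u) v\<close> of the ambient Euclidean space.\<close>

definition local_hypersurface ::
    "(real^'n::finite) set \<Rightarrow> (real^'n \<Rightarrow> real^'m::finite) \<Rightarrow> (real^'n \<Rightarrow> real^'m) \<Rightarrow> bool" where
  "local_hypersurface D y \<nu> \<longleftrightarrow>
     smooth_on y D \<and> smooth_on \<nu> D \<and>
     (\<forall>u\<in>D. inj (frechet_derivative y (at u)) \<and> norm (\<nu> u) = 1 \<and>
        (\<forall>v. \<nu> u \<bullet> frechet_derivative y (at u) v = 0))"

definition principal_direction ::
    "(real^'n::finite \<Rightarrow> real^'m::finite) \<Rightarrow> (real^'n \<Rightarrow> real^'m) \<Rightarrow> real^'n \<Rightarrow> real \<Rightarrow> real^'n \<Rightarrow> bool" where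
  "principal_direction y \<nu> u \<kappa> v \<longleftrightarrow>
     v \<noteq> 0 \<and> frechet_derivative \<nu> (at u) v = - \<kappa> *\<^sub>R frechet_derivative y (at u) v"

text \<open>\<open>e i u\<close> and \<open>k i u\<close> are the \<open>i\<close>-th principal vector and principal curvature at \<open>u\<close>.
  No continuity in \<open>u\<close> is demanded: the mean radius and \<open>\<rho>\<close> below do not depend on the choice of the
  frame, and all other quantities involve only the value of \<open>e\<close> at the point under
  consideration. So a frame always exists, without any assumption on the
  multiplicities of the principal curvatures.\<close>

definition principal_frame ::
    "(real^'n) set \<Rightarrow> (real^'n \<Rightarrow> real^'m::finite) \<Rightarrow> (real^'n \<Rightarrow> real^'m) \<Rightarrow>
     ('n \<Rightarrow> real^'n \<Rightarrow> real^'n) \<Rightarrow> ('n::finite \<Rightarrow> real^'n \<Rightarrow> real) \<Rightarrow> bool" where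
  "principal_frame D y \<nu> e k \<longleftrightarrow>
     (\<forall>u\<in>D. \<forall>i. principal_direction y \<nu> u (k i u) (e i u) \<and>
        (\<forall>j. frechet_derivative y (at u) (e i u) \<bullet> frechet_derivative y (at u) (e j u)
              = (if i = j then 1 else 0)))"

definition radius :: "('n \<Rightarrow> real^'n \<Rightarrow> real) \<Rightarrow> 'n::finite \<Rightarrow> real^'n \<Rightarrow> real" where
  "radius k i u = 1 / k i u"

definition mean_radius :: "('n \<Rightarrow> real^'n \<Rightarrow> real) \<Rightarrow> real^'n::finite \<Rightarrow> real" where
  "mean_radius k u = (1 / real CARD('n)) * (\<Sum>i\<in>UNIV. radius k i u)"

definition rho :: "('n \<Rightarrow> real^'n \<Rightarrow> real) \<Rightarrow> real^'n::finite \<Rightarrow> real" where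
  "rho k u = sqrt (\<Sum>i\<in>UNIV. (mean_radius k u - radius k i u)\<^sup>2)"

definition log_rho :: "('n \<Rightarrow> real^'n \<Rightarrow> real) \<Rightarrow> real^'n::finite \<Rightarrow> real" where
  "log_rho k u = ln (rho k u)"

definition third_form :: "(real^'n::finite \<Rightarrow> real^'m::finite) \<Rightarrow> real^'n \<Rightarrow> real^'n^'n" where
  "third_form \<nu> u = (\<chi> i j. frechet_derivative \<nu> (at u) (axis i 1) \<bullet>
                             frechet_derivative \<nu> (at u) (axis j 1))"

definition laguerre_metric ::
    "(real^'n \<Rightarrow> real^'m::finite) \<Rightarrow> ('n \<Rightarrow> real^'n \<Rightarrow> real) \<Rightarrow>
     real^'n \<Rightarrow> real^'n \<Rightarrow> real^'n::finite \<Rightarrow> real" where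
  "laguerre_metric \<nu> k u v w = (rho k u)\<^sup>2 * (v \<bullet> (third_form \<nu> u *v w))"

definition laguerre_frame ::
    "('n \<Rightarrow> real^'n \<Rightarrow> real^'n) \<Rightarrow> ('n \<Rightarrow> real^'n \<Rightarrow> real) \<Rightarrow> 'n::finite \<Rightarrow> real^'n \<Rightarrow> real^'n" where
  "laguerre_frame e k i u = (radius k i u / rho k u) *\<^sub>R e i u"

text \<open>The dual coframe of the orthonormal frame \<open>laguerre_frame e k\<close>.\<close>

definition laguerre_coframe ::
    "(real^'n \<Rightarrow> real^'m::finite) \<Rightarrow> ('n \<Rightarrow> real^'n \<Rightarrow> real^'n) \<Rightarrow> ('n \<Rightarrow> real^'n \<Rightarrow> real) \<Rightarrow>
     'n::finite \<Rightarrow> real^'n \<Rightarrow> real^'n \<Rightarrow> real" where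
  "laguerre_coframe \<nu> e k i u v = laguerre_metric \<nu> k u (laguerre_frame e k i u) v"

definition laguerre_form_coeff ::
    "('n \<Rightarrow> real^'n \<Rightarrow> real^'n) \<Rightarrow> ('n \<Rightarrow> real^'n \<Rightarrow> real) \<Rightarrow> 'n::finite \<Rightarrow> real^'n \<Rightarrow> real" where
  "laguerre_form_coeff e k i u =
     - (1 / (rho k u)\<^sup>2) * radius k i u *
       (frechet_derivative (mean_radius k) (at u) (e i u)
        - (mean_radius k u - radius k i u) * frechet_derivative (log_rho k) (at u) (e i u))"

definition laguerre_form ::
    "(real^'n \<Rightarrow> real^'m::finite) \<Rightarrow> ('n \<Rightarrow> real^'n \<Rightarrow> real^'n) \<Rightarrow> ('n \<Rightarrow> real^'n \<Rightarrow> real) \<Rightarrow>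
     real^'n::finite \<Rightarrow> real^'n \<Rightarrow> real" where
  "laguerre_form \<nu> e k u v =
     (\<Sum>i\<in>UNIV. laguerre_form_coeff e k i u * laguerre_coframe \<nu> e k i u v)"

definition laguerre_tensor_coeff ::
    "(real^'n \<Rightarrow> real^'m::finite) \<Rightarrow> ('n \<Rightarrow> real^'n \<Rightarrow> real^'n) \<Rightarrow> ('n \<Rightarrow> real^'n \<Rightarrow> real) \<Rightarrow>
     'n::finite \<Rightarrow> 'n \<Rightarrow> real^'n \<Rightarrow> real" where
  "laguerre_tensor_coeff \<nu> e k i j u =
     (1 / (rho k u)\<^sup>2) *
       (hessian (third_form \<nu>) (log_rho k) u (radius k i u *\<^sub>R e i u) (radius k j u *\<^sub>R e j u)
        - radius k i u * radius k j u * frechet_derivative (log_rho k) (at u) (e i u)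
            * frechet_derivative (log_rho k) (at u) (e j u)
        + (1/2) * (gradient_norm_sq (third_form \<nu>) (log_rho k) u - 1) * (if i = j then 1 else 0))"

definition local_L_isotropic ::
    "(real^'n::finite) set \<Rightarrow> (real^'n \<Rightarrow> real^'m::finite) \<Rightarrow> (real^'n \<Rightarrow> real^'m) \<Rightarrow> real \<Rightarrow> bool" where
  "local_L_isotropic D y \<nu> lam \<longleftrightarrow>
     (\<exists>e k. principal_frame D y \<nu> e k \<and>
       (\<forall>u\<in>D.
          (\<forall>i. k i u \<noteq> 0) \<and>
          (\<exists>i j. k i u \<noteq> k j u) \<and>
          (\<forall>v. laguerre_form \<nu> e k u v = 0) \<and>
          (\<forall>i j. laguerre_tensor_coeff \<nu> e k i j u = (if i = j then lam else 0))))"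

section \<open>Hypersurfaces\<close>

definition immersed_hypersurface ::
    "('p, 'n::finite) chart set \<Rightarrow> ('p \<Rightarrow> real^'m::finite) \<Rightarrow> ('p \<Rightarrow> real^'m) \<Rightarrow> bool" where
  "immersed_hypersurface A x \<xi> \<longleftrightarrow>
     (\<forall>c\<in>A. local_hypersurface (chart_image c) (in_chart c x) (in_chart c \<xi>))"

text \<open>The conjunct excluding umbilic points in \<open>local_L_isotropic\<close> ensures \<open>\<rho> > 0\<close>.\<close>

definition L_isotropic ::
    "('p, 'n::finite) chart set \<Rightarrow> ('p \<Rightarrow> real^'m::finite) \<Rightarrow> ('p \<Rightarrow> real^'m) \<Rightarrow> real \<Rightarrow> bool" where
  "L_isotropic A x \<xi> lam \<longleftrightarrow>
     (\<forall>c\<in>A. local_L_isotropic (chart_image c) (in_chart c x) (in_chart c \<xi>) lam)"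

definition principal_curvatures ::
    "('p, 'n::finite) chart set \<Rightarrow> ('p \<Rightarrow> real^'m::finite) \<Rightarrow> ('p \<Rightarrow> real^'m) \<Rightarrow> 'p \<Rightarrow> real set" where
  "principal_curvatures A x \<xi> p =
     {\<kappa>. \<exists>c\<in>A. p \<in> fst c \<and>
        (\<exists>v. principal_direction (in_chart c x) (in_chart c \<xi>) (snd c p) \<kappa> v)}"

end

theory Submission
  imports Defs
begin

text \<open>Suppose that on some nonempty open set there are only two distinct principal curvatures. The
  trace-free operator with eigenvalues \<open>(r - r\<^sub>i) / \<rho>\<close> then has two constant eigenvalues
  \<open>p > q\<close>. The curvature spheres with signed radii \<open>\<alpha>\<^sub>s = \<rho> s - r\<close>, for \<open>s = p, q\<close>, give two maps \<open>C\<^sub>s\<close> into a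
  Lorentz space, and \<open>C\<^sub>q - C\<^sub>p = \<rho> (p - q) N\<close> with \<open>N = (\<nu>, 1)\<close> null. Vanishing of the Laguerre form
  makes each \<open>C\<^sub>s\<close> constant along its own curvature leaves, and the differentials of the two maps are
  orthogonal to each other and to \<open>N\<close>. The equation for the Laguerre tensor says that \<open>1 / \<rho>\<close> is an
  affine function of \<open>\<nu>\<close>; its coefficients form a fixed Lorentz vector of square \<open>2 \<lambda>\<close> that is
  orthogonal to both differentials. Differentiating the orthogonality relations twice shows that
  \<open>\<langle>D\<^sup>2C\<^sub>q(v,v), D\<^sup>2C\<^sub>p(w,w)\<rangle> = \<langle>D\<^sup>2C\<^sub>q(w,v), D\<^sup>2C\<^sub>p(v,w)\<rangle>\<close>. For principal vectors \<open>v\<close>, \<open>w\<close> of the two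
  curvatures, the right side is \<open>0\<close> and the left side is a nonzero multiple of \<open>\<lambda>\<close>, so \<open>\<lambda> = 0\<close>.\<close>

section \<open>Smooth functions\<close>

text \<open>The direction comes first so that \<open>dird v f\<close> is again a function of the
  point and can be differentiated once more, with \<open>v\<close> held fixed.\<close>

abbreviation dird :: "'a \<Rightarrow> ('a::real_normed_vector \<Rightarrow> 'b::real_normed_vector) \<Rightarrow> 'a \<Rightarrow> 'b" where
  "dird v f u \<equiv> frechet_derivative f (at u) v"

lemma dird_eqI: "(f has_derivative f') (at u) \<Longrightarrow> dird v f u = f' v"
  by (metis frechet_derivative_at)

lemma dird_cong:
  assumes "open U" "u \<in> U" "\<And>w. w \<in> U \<Longrightarrow> f w = g w" "f differentiable (at u)"
  shows "dird v f u = dird v g u"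
  using frechet_derivative_transform_within_open[OF assms(4,1,2)] assms(3) by metis

lemma differentiable_cong:
  assumes "open U" "u \<in> U" "\<And>w. w \<in> U \<Longrightarrow> f w = g w" "f differentiable (at u)"
  shows "g differentiable (at u)"
  using assms has_derivative_transform_within_open unfolding differentiable_def by blast

lemma Ck_on_cong:
  assumes "open U" "\<And>u. u \<in> U \<Longrightarrow> f u = g u" "Ck_on k f U"
  shows "Ck_on k g U"
  using assms(2,3)
proof (induction k arbitrary: f g)
  case 0
  then show ?case using continuous_on_cong by (metis Ck_on.simps(1))
next
  case (Suc k)
  have "Ck_on k (dird v g) U" for v
    by (rule Suc.IH[where f = "dird v f"])
      (use Suc.prems assms(1) in \<open>auto intro: dird_cong\<close>)
  then show ?case
    using Suc.prems assms(1) by (auto intro: differentiable_cong)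
qed

lemma Ck_on_Suc_imp: "Ck_on (Suc k) f U \<Longrightarrow> Ck_on k f U"
proof (induction k arbitrary: f)
  case 0
  then show ?case
    by (auto intro!: continuous_at_imp_continuous_on differentiable_imp_continuous_within)
qed auto

lemma Ck_on_const: "Ck_on k (\<lambda>_. c) U"
  by (induction k arbitrary: c) auto

text \<open>Any formula for the derivative will do, so the inductive step can use the usual
  differentiation rules instead of \<open>frechet_derivative\<close> itself.\<close>

lemma Ck_on_SucI:
  assumes "open U" "\<And>u. u \<in> U \<Longrightarrow> (f has_derivative f' u) (at u)"
    "\<And>v. Ck_on k (\<lambda>u. f' u v) U"
  shows "Ck_on (Suc k) f U"
proof -
  have "Ck_on k (dird v f) U" for v
    by (rule Ck_on_cong[OF assms(1) _ assms(3)[of v]]) (simp add: dird_eqI[OF assms(2)])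
  then show ?thesis
    using assms(2) by (auto simp: differentiable_def)
qed

lemma Ck_on_Suc_has_derivative:
  "Ck_on (Suc k) f U \<Longrightarrow> u \<in> U \<Longrightarrow> (f has_derivative (\<lambda>v. dird v f u)) (at u)"
  using frechet_derivative_works by auto

lemma Ck_on_add:
  assumes "open U" "Ck_on k f U" "Ck_on k g U"
  shows "Ck_on k (\<lambda>u. f u + g u) U"
  using assms(2,3)
proof (induction k arbitrary: f g)
  case 0
  then show ?case by (simp add: continuous_on_add)
next
  case (Suc k)
  show ?case
  proof (rule Ck_on_SucI[OF assms(1)])
    show "((\<lambda>u. f u + g u) has_derivative (\<lambda>v. dird v f u + dird v g u)) (at u)" if "u \<in> U" for u
      by (intro has_derivative_add Ck_on_Suc_has_derivative[OF Suc.prems(1) that] Ck_on_Suc_has_derivative[OF Suc.prems(2) that])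
    show "Ck_on k (\<lambda>u. dird v f u + dird v g u) U" for v
      by (rule Suc.IH) (use Suc.prems in auto)
  qed
qed

text \<open>By the Leibniz rule the derivative is a sum of two products of the same kind, so the
  induction runs over all pairs of factors. Products, inner products and scalings are
  instances.\<close>

lemma (in bounded_bilinear) Ck_on:
  assumes "open U" "Ck_on k f U" "Ck_on k g U"
  shows "Ck_on k (\<lambda>u. prod (f u) (g u)) U"
  using assms(2,3)
proof (induction k arbitrary: f g)
  case 0
  then show ?case by (simp add: continuous_on)
next
  case (Suc k)
  show ?case
  proof (rule Ck_on_SucI[OF assms(1)])
    show "((\<lambda>u. prod (f u) (g u)) has_derivative
      (\<lambda>v. prod (f u) (dird v g u) + prod (dird v f u) (g u))) (at u)" if "u \<in> U" for u
      by (intro FDERIV Ck_on_Suc_has_derivative[OF Suc.prems(1) that] Ck_on_Suc_has_derivative[OF Suc.prems(2) that])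
    show "Ck_on k (\<lambda>u. prod (f u) (dird v g u) + prod (dird v f u) (g u)) U" for v
      using Suc.prems
      by (intro Ck_on_add Suc.IH assms(1) Ck_on_Suc_imp[OF Suc.prems(1)] Ck_on_Suc_imp[OF Suc.prems(2)])
        simp_all
  qed
qed

lemmas Ck_on_mult = bounded_bilinear.Ck_on[OF bounded_bilinear_mult]

text \<open>The inductions below close because the derivative of \<open>h \<circ> f\<close> is again a polynomial
  in \<open>h \<circ> f\<close> (or its inverse) and the derivative of \<open>f\<close>.\<close>

lemma Ck_on_inverse:
  fixes f :: "'a::real_normed_vector \<Rightarrow> real"
  assumes "open U" "Ck_on k f U" "\<And>u. u \<in> U \<Longrightarrow> f u \<noteq> 0"
  shows "Ck_on k (\<lambda>u. inverse (f u)) U"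
  using assms(2)
proof (induction k)
  case 0
  then show ?case using assms(3) by (auto intro: continuous_on_inverse)
next
  case (Suc k)
  have IH: "Ck_on k (\<lambda>u. inverse (f u)) U"
    using Suc.IH Ck_on_Suc_imp[OF Suc.prems] by blast
  show ?case
  proof (rule Ck_on_SucI[OF assms(1)])
    show "((\<lambda>u. inverse (f u)) has_derivative
      (\<lambda>v. (- 1) * (inverse (f u) * dird v f u * inverse (f u)))) (at u)" if "u \<in> U" for u
      using Deriv.has_derivative_inverse[OF assms(3)[OF that] Ck_on_Suc_has_derivative[OF Suc.prems that]]
      by simp
    show "Ck_on k (\<lambda>u. (- 1) * (inverse (f u) * dird v f u * inverse (f u))) U" for v
      using Suc.prems by (intro Ck_on_mult Ck_on_const assms(1) IH) simp_all
  qed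
qed

lemma Ck_on_sqrt:
  fixes f :: "'a::real_normed_vector \<Rightarrow> real"
  assumes "open U" "Ck_on k f U" "\<And>u. u \<in> U \<Longrightarrow> f u > 0"
  shows "Ck_on k (\<lambda>u. sqrt (f u)) U"
  using assms(2)
proof (induction k)
  case 0
  then show ?case by (auto intro: continuous_on_real_sqrt)
next
  case (Suc k)
  have "Ck_on k (\<lambda>u. sqrt (f u)) U"
    using Suc.IH Ck_on_Suc_imp[OF Suc.prems] by blast
  then have inv: "Ck_on k (\<lambda>u. inverse (sqrt (f u))) U"
    by (rule Ck_on_inverse[OF assms(1)]) (use assms(3) in force)
  show ?case
  proof (rule Ck_on_SucI[OF assms(1)])
    show "((\<lambda>u. sqrt (f u)) has_derivative (\<lambda>v. (1/2) * (inverse (sqrt (f u)) * dird v f u))) (at u)"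
      if "u \<in> U" for u
      using has_derivative_real_sqrt[OF assms(3)[OF that] Ck_on_Suc_has_derivative[OF Suc.prems that]]
      by (simp add: field_simps)
    show "Ck_on k (\<lambda>u. (1/2) * (inverse (sqrt (f u)) * dird v f u)) U" for v
      using Suc.prems by (intro Ck_on_mult Ck_on_const assms(1) inv) simp_all
  qed
qed

lemma Ck_on_ln:
  fixes f :: "'a::real_normed_vector \<Rightarrow> real"
  assumes "open U" "Ck_on k f U" "\<And>u. u \<in> U \<Longrightarrow> f u > 0"
  shows "Ck_on k (\<lambda>u. ln (f u)) U"
proof (cases k)
  case 0
  have "continuous_on U f" using assms(2) 0 by simp
  then show ?thesis using assms(3) 0 by (auto intro!: continuous_on_ln simp: order_less_imp_not_eq2)
next
  case (Suc j)
  note f = assms(2)[unfolded Suc]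
  show ?thesis
    unfolding Suc
  proof (rule Ck_on_SucI[OF assms(1)])
    show "((\<lambda>u. ln (f u)) has_derivative (\<lambda>v. inverse (f u) * dird v f u)) (at u)" if "u \<in> U" for u
      using has_derivative_ln[OF assms(3)[OF that] Ck_on_Suc_has_derivative[OF f that]]
      by (simp add: field_simps)
    have "Ck_on j (\<lambda>u. inverse (f u)) U"
      by (rule Ck_on_inverse[OF assms(1) Ck_on_Suc_imp[OF f]]) (use assms(3) in force)
    then show "Ck_on j (\<lambda>u. inverse (f u) * dird v f u) U" for v
      using f by (intro Ck_on_mult assms(1)) simp_all
  qed
qed

lemma smooth_on_cong: "open U \<Longrightarrow> (\<And>u. u \<in> U \<Longrightarrow> f u = g u) \<Longrightarrow> smooth_on f U \<Longrightarrow> smooth_on g U"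
  unfolding smooth_on_def using Ck_on_cong by metis

lemma Ck_on_subset: "Ck_on k f U \<Longrightarrow> V \<subseteq> U \<Longrightarrow> Ck_on k f V"
  by (induction k arbitrary: f) (auto intro: continuous_on_subset)

lemma smooth_on_subset: "smooth_on f U \<Longrightarrow> V \<subseteq> U \<Longrightarrow> smooth_on f V"
  unfolding smooth_on_def using Ck_on_subset by blast

lemma smooth_on_has_derivative:
  "smooth_on f U \<Longrightarrow> u \<in> U \<Longrightarrow> (f has_derivative (\<lambda>v. dird v f u)) (at u)"
  unfolding smooth_on_def using frechet_derivative_works Ck_on.simps(2) by (metis (mono_tags))

lemma smooth_on_differentiable: "smooth_on f U \<Longrightarrow> u \<in> U \<Longrightarrow> f differentiable (at u)"
  using smooth_on_has_derivative differentiable_def by blast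

lemma smooth_on_dird: "smooth_on f U \<Longrightarrow> smooth_on (dird v f) U"
  unfolding smooth_on_def by (metis Ck_on.simps(2))

lemma smooth_on_continuous: "smooth_on f U \<Longrightarrow> continuous_on U f"
  unfolding smooth_on_def by (metis Ck_on.simps(1))

lemma smooth_on_linear_dird: "smooth_on f U \<Longrightarrow> u \<in> U \<Longrightarrow> linear (\<lambda>v. dird v f u)"
  by (simp add: linear_frechet_derivative smooth_on_differentiable)

lemma smooth_on_const: "smooth_on (\<lambda>_. c) U"
  by (simp add: smooth_on_def Ck_on_const)

lemma smooth_on_add: "open U \<Longrightarrow> smooth_on f U \<Longrightarrow> smooth_on g U \<Longrightarrow> smooth_on (\<lambda>u. f u + g u) U"
  by (simp add: smooth_on_def Ck_on_add)

lemma (in bounded_bilinear) smooth_on: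
  "open U \<Longrightarrow> smooth_on f U \<Longrightarrow> smooth_on g U \<Longrightarrow> smooth_on (\<lambda>u. prod (f u) (g u)) U"
  by (simp add: smooth_on_def Ck_on)

lemma Ck_on_bounded_linear:
  assumes "bounded_linear L" "open U" "Ck_on k f U"
  shows "Ck_on k (\<lambda>u. L (f u)) U"
  using assms(3)
proof (induction k arbitrary: f)
  case 0
  then show ?case by (simp add: bounded_linear.continuous_on[OF assms(1)])
next
  case (Suc k)
  show ?case
  proof (rule Ck_on_SucI[OF assms(2)])
    show "((\<lambda>u. L (f u)) has_derivative (\<lambda>v. L (dird v f u))) (at u)" if "u \<in> U" for u
      by (rule bounded_linear.has_derivative[OF assms(1) Ck_on_Suc_has_derivative[OF Suc.prems that]])
    show "Ck_on k (\<lambda>u. L (dird v f u)) U" for v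
      by (rule Suc.IH) (use Suc.prems in simp)
  qed
qed

lemma smooth_on_bounded_linear:
  "bounded_linear L \<Longrightarrow> open U \<Longrightarrow> smooth_on f U \<Longrightarrow> smooth_on (\<lambda>u. L (f u)) U"
  by (simp add: smooth_on_def Ck_on_bounded_linear)

lemmas smooth_on_mult = bounded_bilinear.smooth_on[OF bounded_bilinear_mult]
lemmas smooth_on_inner = bounded_bilinear.smooth_on[OF bounded_bilinear_inner]
lemmas smooth_on_scaleR = bounded_bilinear.smooth_on[OF bounded_bilinear_scaleR]
lemmas smooth_on_minus = smooth_on_bounded_linear[OF bounded_linear_minus[OF bounded_linear_ident]]

lemma smooth_on_diff:
  "open U \<Longrightarrow> smooth_on f U \<Longrightarrow> smooth_on g U \<Longrightarrow> smooth_on (\<lambda>u. f u - g u) U"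
  using smooth_on_add[of U f "\<lambda>u. - g u"] smooth_on_minus[of U g] by simp

lemma smooth_on_Pair:
  assumes "open U" "smooth_on f U" "smooth_on g U"
  shows "smooth_on (\<lambda>u. (f u, g u)) U"
proof -
  have "bounded_linear (\<lambda>x. (x, 0))" "bounded_linear (\<lambda>x. (0, x))"
    by (auto intro!: bounded_linear_Pair bounded_linear_ident bounded_linear_zero)
  from smooth_on_add[OF assms(1) smooth_on_bounded_linear[OF this(1) assms(1,2)]
      smooth_on_bounded_linear[OF this(2) assms(1,3)]]
  show ?thesis by simp
qed

lemma smooth_on_sum:
  "open U \<Longrightarrow> (\<And>i. i \<in> I \<Longrightarrow> smooth_on (f i) U) \<Longrightarrow> smooth_on (\<lambda>u. \<Sum>i\<in>I. f i u) U"
  by (induction I rule: infinite_finite_induct) (auto intro: smooth_on_const smooth_on_add)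

lemma smooth_on_prod:
  fixes f :: "'i \<Rightarrow> 'a::real_normed_vector \<Rightarrow> real"
  shows "open U \<Longrightarrow> (\<And>i. i \<in> I \<Longrightarrow> smooth_on (f i) U) \<Longrightarrow> smooth_on (\<lambda>u. \<Prod>i\<in>I. f i u) U"
  by (induction I rule: infinite_finite_induct) (auto intro: smooth_on_const smooth_on_mult)

lemma smooth_on_inverse:
  fixes f :: "'a::real_normed_vector \<Rightarrow> real"
  shows "open U \<Longrightarrow> smooth_on f U \<Longrightarrow> (\<And>u. u \<in> U \<Longrightarrow> f u \<noteq> 0) \<Longrightarrow> smooth_on (\<lambda>u. inverse (f u)) U"
  by (simp add: smooth_on_def Ck_on_inverse)

lemma smooth_on_sqrt:
  fixes f :: "'a::real_normed_vector \<Rightarrow> real"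
  shows "open U \<Longrightarrow> smooth_on f U \<Longrightarrow> (\<And>u. u \<in> U \<Longrightarrow> f u > 0) \<Longrightarrow> smooth_on (\<lambda>u. sqrt (f u)) U"
  by (simp add: smooth_on_def Ck_on_sqrt)

lemma smooth_on_ln:
  fixes f :: "'a::real_normed_vector \<Rightarrow> real"
  shows "open U \<Longrightarrow> smooth_on f U \<Longrightarrow> (\<And>u. u \<in> U \<Longrightarrow> f u > 0) \<Longrightarrow> smooth_on (\<lambda>u. ln (f u)) U"
  by (simp add: smooth_on_def Ck_on_ln)

section \<open>Determinants and inverses of smooth matrices\<close>

lemma smooth_on_det:
  fixes A :: "'a::real_normed_vector \<Rightarrow> real^'n^'n"
  assumes "open U" "\<And>i j. smooth_on (\<lambda>u. A u $ i $ j) U"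
  shows "smooth_on (\<lambda>u. det (A u)) U"
  unfolding det_def
  by (intro smooth_on_sum smooth_on_mult smooth_on_prod smooth_on_const assms)

lemma invertible_matrix_inv:
  fixes A :: "'a::semiring_1^'n^'n"
  assumes "invertible A"
  shows "A ** matrix_inv A = mat 1 \<and> matrix_inv A ** A = mat 1"
  unfolding matrix_inv_def by (rule someI_ex) (use assms invertible_def in blast)

text \<open>By Cramer's rule each entry of the inverse is a quotient of determinants of smooth
  matrices.\<close>

lemma smooth_on_matrix_inv:
  fixes A :: "'a::real_normed_vector \<Rightarrow> real^'n^'n"
  assumes U: "open U" and A: "\<And>i j. smooth_on (\<lambda>u. A u $ i $ j) U"
    and inv: "\<And>u. u \<in> U \<Longrightarrow> invertible (A u)"
  shows "smooth_on (\<lambda>u. matrix_inv (A u) $ i $ j) U"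
proof -
  \<comment> \<open>Column \<open>i\<close> is replaced by the \<open>j\<close>-th unit vector:
    entry \<open>(i, j)\<close> of the inverse is coordinate \<open>i\<close> of the solution of
    \<open>A x = axis j 1\<close>.\<close>
  let ?C = "\<lambda>u. \<chi> k l. if l = i then axis j 1 $ k else A u $ k $ l"
  have nz: "det (A u) \<noteq> 0" if "u \<in> U" for u
    using inv[OF that] invertible_det_nz by blast
  have eq: "det (?C u) * inverse (det (A u)) = matrix_inv (A u) $ i $ j" if u: "u \<in> U" for u
  proof -
    have "A u *v (matrix_inv (A u) *v axis j 1) = axis j 1"
      using inv[OF u] by (simp add: matrix_vector_mul_assoc invertible_matrix_inv)
    then have "matrix_inv (A u) *v axis j 1 = (\<chi> k. det (\<chi> p l. if l = k then axis j 1 $ p else A u $ p $ l) / det (A u))"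
      using cramer[OF nz[OF u]] by blast
    moreover have "(matrix_inv (A u) *v axis j 1) $ i = matrix_inv (A u) $ i $ j"
      by (simp add: matrix_vector_mul_component inner_axis)
    ultimately show ?thesis by (simp add: divide_inverse)
  qed
  have "smooth_on (\<lambda>u. det (?C u)) U"
  proof (rule smooth_on_det[OF U])
    show "smooth_on (\<lambda>u. ?C u $ k $ l) U" for k l
      using A[of k l] by (cases "l = i") (simp_all add: smooth_on_const)
  qed
  from smooth_on_mult[OF U this smooth_on_inverse[OF U smooth_on_det[OF U A] nz]]
  show ?thesis
    by (rule smooth_on_cong[OF U eq, rotated])
qed

text \<open>Schwarz's theorem: by the mean value theorem, used twice, the second difference over a small
  parallelogram is a value of either mixed derivative.\<close>

lemma second_difference:
  fixes f :: "'a::real_normed_vector \<Rightarrow> real"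
  assumes f: "smooth_on f U" and h: "h > 0"
    and sub: "\<And>s t. 0 \<le> s \<Longrightarrow> s \<le> h \<Longrightarrow> 0 \<le> t \<Longrightarrow> t \<le> h \<Longrightarrow> a + s *\<^sub>R v + t *\<^sub>R w \<in> U"
  obtains s t where "0 < s" "s < h" "0 < t" "t < h"
    "f (a + h *\<^sub>R v + h *\<^sub>R w) - f (a + h *\<^sub>R v) - f (a + h *\<^sub>R w) + f a
      = h\<^sup>2 * dird w (dird v f) (a + s *\<^sub>R v + t *\<^sub>R w)"
proof -
  let ?p = "\<lambda>s. f (a + s *\<^sub>R v + h *\<^sub>R w) - f (a + s *\<^sub>R v + 0 *\<^sub>R w)"
  have dv: "((\<lambda>s. g (a + s *\<^sub>R v + t *\<^sub>R w)) has_real_derivative dird v g (a + s *\<^sub>R v + t *\<^sub>R w)) (at s)"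
    if "smooth_on g U" "0 \<le> s" "s \<le> h" "0 \<le> t" "t \<le> h" for g :: "'a \<Rightarrow> real" and s t
  proof -
    note D = smooth_on_has_derivative[OF that(1) sub[OF that(2-5)]]
    have "((\<lambda>s. a + s *\<^sub>R v + t *\<^sub>R w) has_derivative (\<lambda>s. s *\<^sub>R v)) (at s)"
      by (rule has_derivative_eq_rhs, (rule derivative_intros)+) simp
    from has_derivative_compose[OF this D] have
      "((\<lambda>s. g (a + s *\<^sub>R v + t *\<^sub>R w)) has_derivative (\<lambda>x. dird (x *\<^sub>R v) g (a + s *\<^sub>R v + t *\<^sub>R w))) (at s)" .
    moreover have "dird (x *\<^sub>R v) g (a + s *\<^sub>R v + t *\<^sub>R w) = dird v g (a + s *\<^sub>R v + t *\<^sub>R w) * x" for x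
      using linear_cmul[OF smooth_on_linear_dird[OF that(1) sub[OF that(2-5)]]] by simp
    ultimately show ?thesis
      by (simp add: has_field_derivative_def)
  qed
  have dw: "((\<lambda>t. g (a + s *\<^sub>R v + t *\<^sub>R w)) has_real_derivative dird w g (a + s *\<^sub>R v + t *\<^sub>R w)) (at t)"
    if "smooth_on g U" "0 \<le> s" "s \<le> h" "0 \<le> t" "t \<le> h" for g :: "'a \<Rightarrow> real" and s t
  proof -
    note D = smooth_on_has_derivative[OF that(1) sub[OF that(2-5)]]
    have "((\<lambda>t. a + s *\<^sub>R v + t *\<^sub>R w) has_derivative (\<lambda>t. t *\<^sub>R w)) (at t)"
      by (rule has_derivative_eq_rhs, (rule derivative_intros)+) simp
    from has_derivative_compose[OF this D] have
      "((\<lambda>t. g (a + s *\<^sub>R v + t *\<^sub>R w)) has_derivative (\<lambda>x. dird (x *\<^sub>R w) g (a + s *\<^sub>R v + t *\<^sub>R w))) (at t)" .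
    moreover have "dird (x *\<^sub>R w) g (a + s *\<^sub>R v + t *\<^sub>R w) = dird w g (a + s *\<^sub>R v + t *\<^sub>R w) * x" for x
      using linear_cmul[OF smooth_on_linear_dird[OF that(1) sub[OF that(2-5)]]] by simp
    ultimately show ?thesis
      by (simp add: has_field_derivative_def)
  qed
  have "\<exists>s. 0 < s \<and> s < h \<and> ?p h - ?p 0 =
      (h - 0) * (dird v f (a + s *\<^sub>R v + h *\<^sub>R w) - dird v f (a + s *\<^sub>R v + 0 *\<^sub>R w))"
    by (rule MVT2[OF h]) (intro DERIV_diff dv[OF f]; use h in simp)
  then obtain s where s: "0 < s" "s < h" "?p h - ?p 0 =
      h * (dird v f (a + s *\<^sub>R v + h *\<^sub>R w) - dird v f (a + s *\<^sub>R v + 0 *\<^sub>R w))"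
    by auto
  have "\<exists>t. 0 < t \<and> t < h \<and> dird v f (a + s *\<^sub>R v + h *\<^sub>R w) - dird v f (a + s *\<^sub>R v + 0 *\<^sub>R w)
      = (h - 0) * dird w (dird v f) (a + s *\<^sub>R v + t *\<^sub>R w)"
    by (rule MVT2[OF h]) (intro dw[OF smooth_on_dird[OF f]]; use s h in simp)
  then obtain t where "0 < t" "t < h"
    "dird v f (a + s *\<^sub>R v + h *\<^sub>R w) - dird v f (a + s *\<^sub>R v + 0 *\<^sub>R w)
      = h * dird w (dird v f) (a + s *\<^sub>R v + t *\<^sub>R w)"
    by auto
  with s show ?thesis
    by (intro that[of s t]) (auto simp: power2_eq_square)
qed

text \<open>The second difference is symmetric in \<open>v\<close> and \<open>w\<close>, so the two
  mixed derivatives agree at a pair of points near \<open>a\<close>; continuity of both carries the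
  equality to \<open>a\<close>.\<close>

lemma dird_commute_real:
  fixes f :: "'a::real_normed_vector \<Rightarrow> real"
  assumes U: "open U" "a \<in> U" and f: "smooth_on f U"
  shows "dird v (dird w f) a = dird w (dird v f) a"
proof -
  let ?F = "dird w (dird v f)" and ?G = "dird v (dird w f)"
  have "\<bar>?F a - ?G a\<bar> \<le> e" if e: "e > 0" for e
  proof -
    have "isCont ?F a" "isCont ?G a"
      using smooth_on_continuous[OF smooth_on_dird[OF smooth_on_dird[OF f]]] U
      by (metis continuous_on_eq_continuous_at)+
    then have "\<exists>d>0. \<forall>x. dist x a < d \<longrightarrow> dist (?F x) (?F a) < e/2"
      "\<exists>d>0. \<forall>x. dist x a < d \<longrightarrow> dist (?G x) (?G a) < e/2"
      unfolding continuous_at_eps_delta using half_gt_zero[OF e] by blast+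
    then obtain d1 d2 where d: "d1 > 0" "\<And>x. dist x a < d1 \<Longrightarrow> dist (?F x) (?F a) < e/2"
      "d2 > 0" "\<And>x. dist x a < d2 \<Longrightarrow> dist (?G x) (?G a) < e/2"
      by metis
    obtain d3 where d3: "d3 > 0" "ball a d3 \<subseteq> U" using U open_contains_ball by blast
    define c where "c = norm v + norm w + 1"
    have c: "c > 0" by (simp add: c_def add_nonneg_pos)
    \<comment> \<open>Small enough that every point of the parallelogram with sides
      \<open>h v\<close> and \<open>h w\<close> lies in \<open>U\<close> and within both continuity
      radii; the summand 1 in \<open>c\<close> keeps the divisor positive.\<close>
    define h where "h = min d1 (min d2 d3) / c / 2"
    have h: "h > 0" using d d3 c by (simp add: h_def)
    have near: "dist (a + s *\<^sub>R v + t *\<^sub>R w) a < min d1 (min d2 d3)"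
      if "0 \<le> s" "s \<le> h" "0 \<le> t" "t \<le> h" for s t
    proof -
      have "dist (a + s *\<^sub>R v + t *\<^sub>R w) a \<le> norm (s *\<^sub>R v) + norm (t *\<^sub>R w)"
        by (simp add: dist_norm add.assoc norm_triangle_ineq del: norm_scaleR)
      also have "\<dots> \<le> h * norm v + h * norm w"
        using that by (auto intro!: add_mono mult_right_mono)
      also have "\<dots> \<le> h * c" using h by (simp add: c_def algebra_simps)
      also have "\<dots> < min d1 (min d2 d3)"
        using c d(1,3) d3(1) by (simp add: h_def) (auto simp: min_def)
      finally show ?thesis .
    qed
    have near': "dist (a + s *\<^sub>R w + t *\<^sub>R v) a < min d1 (min d2 d3)"
      if "0 \<le> s" "s \<le> h" "0 \<le> t" "t \<le> h" for s t
      using near[OF that(3,4,1,2)] by (simp add: add.assoc add.commute[of "s *\<^sub>R w"])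
    have sub: "a + s *\<^sub>R v + t *\<^sub>R w \<in> U" if "0 \<le> s" "s \<le> h" "0 \<le> t" "t \<le> h" for s t
      using near[OF that] d3(2) by (auto simp: dist_commute)
    have sub': "a + s *\<^sub>R w + t *\<^sub>R v \<in> U" if "0 \<le> s" "s \<le> h" "0 \<le> t" "t \<le> h" for s t
      using near'[OF that] d3(2) by (auto simp: dist_commute)
    obtain s t where 1: "0 < s" "s < h" "0 < t" "t < h"
      "f (a + h *\<^sub>R v + h *\<^sub>R w) - f (a + h *\<^sub>R v) - f (a + h *\<^sub>R w) + f a = h\<^sup>2 * ?F (a + s *\<^sub>R v + t *\<^sub>R w)"
      by (rule second_difference[OF f h sub]) (assumption | rule that)+
    obtain s' t' where 2: "0 < s'" "s' < h" "0 < t'" "t' < h"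
      "f (a + h *\<^sub>R w + h *\<^sub>R v) - f (a + h *\<^sub>R w) - f (a + h *\<^sub>R v) + f a = h\<^sup>2 * ?G (a + s' *\<^sub>R w + t' *\<^sub>R v)"
      by (rule second_difference[OF f h sub']) (assumption | rule that)+
    have "a + h *\<^sub>R w + h *\<^sub>R v = a + h *\<^sub>R v + h *\<^sub>R w" by simp
    from 1(5) 2(5)[unfolded this] have "h\<^sup>2 * ?F (a + s *\<^sub>R v + t *\<^sub>R w) = h\<^sup>2 * ?G (a + s' *\<^sub>R w + t' *\<^sub>R v)"
      by linarith
    then have eq: "?F (a + s *\<^sub>R v + t *\<^sub>R w) = ?G (a + s' *\<^sub>R w + t' *\<^sub>R v)"
      using h by simp
    have "dist (?F (a + s *\<^sub>R v + t *\<^sub>R w)) (?F a) < e/2"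
      by (rule d(2)) (use near[of s t] 1(1-4) in simp)
    moreover have "dist (?G (a + s' *\<^sub>R w + t' *\<^sub>R v)) (?G a) < e/2"
      by (rule d(4)) (use near'[of s' t'] 2(1-4) in simp)
    ultimately show ?thesis using eq unfolding dist_real_def by linarith
  qed
  then show ?thesis
    using field_le_epsilon[of "\<bar>?F a - ?G a\<bar>" 0] by simp
qed

lemma dird_bounded_linear:
  "bounded_linear L \<Longrightarrow> f differentiable (at u) \<Longrightarrow> dird v (\<lambda>u. L (f u)) u = L (dird v f u)"
  by (rule dird_eqI[OF bounded_linear.has_derivative]) (simp_all flip: frechet_derivative_works)

text \<open>Taking inner products with a fixed vector \<open>c\<close> reduces this to the
  real-valued case.\<close>

lemma dird_commute:
  fixes f :: "'a::real_normed_vector \<Rightarrow> 'b::real_inner"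
  assumes U: "open U" "a \<in> U" and f: "smooth_on f U"
  shows "dird v (dird w f) a = dird w (dird v f) a"
proof -
  have "dird v (dird w (\<lambda>u. f u \<bullet> c)) a = dird v (dird w f) a \<bullet> c" for v w c
  proof -
    note bl = bounded_linear_inner_left[of c]
    have sm: "smooth_on (\<lambda>u. f u \<bullet> c) U"
      by (rule smooth_on_bounded_linear[OF bl U(1) f])
    have "dird v (dird w (\<lambda>u. f u \<bullet> c)) a = dird v (\<lambda>u. dird w f u \<bullet> c) a"
      by (rule dird_cong[OF U dird_bounded_linear[OF bl smooth_on_differentiable[OF f]]
            smooth_on_differentiable[OF smooth_on_dird[OF sm] U(2)]])
    also have "\<dots> = dird v (dird w f) a \<bullet> c"
      by (rule dird_bounded_linear[OF bl smooth_on_differentiable[OF smooth_on_dird[OF f] U(2)]])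
    finally show ?thesis .
  qed
  then have "dird v (dird w f) a \<bullet> c = dird w (dird v f) a \<bullet> c" for c
    using dird_commute_real[OF U smooth_on_bounded_linear[OF bounded_linear_inner_left[of c] U(1) f],
        where v = v and w = w]
    by simp
  then show ?thesis using vector_eq_rdot by blast
qed

section \<open>Product rules and expansion in coordinates\<close>

lemma dird_bilinear:
  assumes "bounded_bilinear b" "f differentiable (at u)" "g differentiable (at u)"
  shows "dird w (\<lambda>u. b (f u) (g u)) u = b (f u) (dird w g u) + b (dird w f u) (g u)"
  by (rule dird_eqI[OF bounded_bilinear.FDERIV[OF assms(1)]])
    (use assms in \<open>simp_all flip: frechet_derivative_works\<close>)

lemma dird_diff:
  assumes "f differentiable (at u)" "g differentiable (at u)"
  shows "dird w (\<lambda>u. f u - g u) u = dird w f u - dird w g u"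
  by (rule dird_eqI[OF has_derivative_diff]) (use assms in \<open>simp_all flip: frechet_derivative_works\<close>)

lemma dird_Pair:
  assumes "f differentiable (at u)" "g differentiable (at u)"
  shows "dird w (\<lambda>u. (f u, g u)) u = (dird w f u, dird w g u)"
  by (rule dird_eqI[OF has_derivative_Pair]) (use assms in \<open>simp_all flip: frechet_derivative_works\<close>)

lemma dird_sum:
  assumes "\<And>i. i \<in> I \<Longrightarrow> f i differentiable (at u)"
  shows "dird w (\<lambda>u. \<Sum>i\<in>I. f i u) u = (\<Sum>i\<in>I. dird w (f i) u)"
  by (rule dird_eqI[OF has_derivative_sum]) (use assms in \<open>simp_all flip: frechet_derivative_works\<close>)

lemmas dird_mult = dird_bilinear[OF bounded_bilinear_mult]
lemmas dird_inner = dird_bilinear[OF bounded_bilinear_inner]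
lemmas dird_scaleR = dird_bilinear[OF bounded_bilinear_scaleR]

lemma linear_axis_expand:
  fixes f :: "real^'n::finite \<Rightarrow> 'b::real_vector"
  assumes "linear f"
  shows "f v = (\<Sum>i\<in>UNIV. v $ i *\<^sub>R f (axis i 1))"
proof -
  have "f v = f (\<Sum>i\<in>UNIV. v $ i *\<^sub>R axis i 1)"
    using basis_expansion[of v] by (simp add: scalar_mult_eq_scaleR)
  then show ?thesis
    by (simp add: linear_sum[OF assms] linear_cmul[OF assms])
qed

lemma dird_axis_expand:
  fixes f :: "real^'n::finite \<Rightarrow> 'b::real_normed_vector"
  assumes "f differentiable (at u)"
  shows "dird v f u = (\<Sum>i\<in>UNIV. v $ i *\<^sub>R dird (axis i 1) f u)"
  by (rule linear_axis_expand[OF linear_frechet_derivative[OF assms]])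

section \<open>Orthonormal frames and the Lorentz form\<close>

text \<open>The normal and the \<open>n\<close> tangent vectors are \<open>n + 1\<close> orthonormal
  vectors in dimension \<open>n + 1\<close>, hence a basis.\<close>

lemma orthonormal_frame_expand:
  fixes \<nu> :: "real^'m::finite" and t :: "'n::finite \<Rightarrow> real^'m"
  assumes "CARD('m) = CARD('n) + 1" "norm \<nu> = 1" "\<And>i. \<nu> \<bullet> t i = 0"
    "\<And>i j. t i \<bullet> t j = (if i = j then 1 else 0)"
  shows "x = (x \<bullet> \<nu>) *\<^sub>R \<nu> + (\<Sum>i\<in>UNIV. (x \<bullet> t i) *\<^sub>R t i)"
proof -
  let ?S = "insert \<nu> (range t)"
  have nu: "\<nu> \<bullet> \<nu> = 1" using assms(2) by (simp add: norm_eq_1)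
  have "inj t"
    using assms(4) by (metis injI zero_neq_one)
  moreover have notin: "\<nu> \<notin> range t"
    using assms(3) nu by (metis rangeE zero_neq_one)
  ultimately have card: "card ?S = CARD('m)"
    using assms(1) by (simp add: card_image)
  have orth: "pairwise orthogonal ?S"
    using assms(3,4) by (auto simp: pairwise_def orthogonal_def inner_commute)
  have one: "norm i = 1" if "i \<in> ?S" for i
    using that assms(2,4) by (auto simp: norm_eq_1)
  then have "independent ?S"
    by (intro pairwise_orthogonal_independent[OF orth]) (metis norm_zero zero_neq_one)
  then have "span ?S = UNIV"
    using card by (metis DIM_cart DIM_real dim_eq_card dim_eq_full mult.right_neutral)
  then have "(\<Sum>i\<in>?S. (x \<bullet> i) *\<^sub>R i) = x"
    by (intro orthonormal_basis_expand[OF orth one]) auto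
  then show ?thesis
    using notin \<open>inj t\<close> by (simp add: sum.reindex)
qed

lemma orthonormal_frame_inner:
  fixes \<nu> :: "real^'m::finite" and t :: "'n::finite \<Rightarrow> real^'m"
  assumes "CARD('m) = CARD('n) + 1" "norm \<nu> = 1" "\<And>i. \<nu> \<bullet> t i = 0"
    "\<And>i j. t i \<bullet> t j = (if i = j then 1 else 0)"
  shows "x \<bullet> y = (x \<bullet> \<nu>) * (y \<bullet> \<nu>) + (\<Sum>i\<in>UNIV. (x \<bullet> t i) * (y \<bullet> t i))"
  using arg_cong[OF orthonormal_frame_expand[OF assms, of x], of "\<lambda>z. y \<bullet> z"]
  by (simp add: inner_add_right inner_sum_right inner_commute[of x y])

lemma columns_mult_vec: "(\<chi> a i. e i $ a) *v x = (\<Sum>i\<in>UNIV. x $ i *\<^sub>R (e i :: real^'m::finite))"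
  by (subst vec_eq_iff) (simp add: matrix_vector_mult_def mult.commute)

text \<open>Principal vectors are orthonormal only after applying \<open>dy\<close>, not in
  coordinates. Pairing the image of a vanishing combination with \<open>L (e j)\<close> isolates its
  \<open>j\<close>-th coefficient.\<close>

lemma orthonormal_image_basis:
  fixes e :: "'n::finite \<Rightarrow> real^'n" and L :: "real^'n \<Rightarrow> 'b::real_inner"
  assumes "linear L" "\<And>i j. L (e i) \<bullet> L (e j) = (if i = j then 1 else 0)"
  shows "invertible (\<chi> a i. e i $ a)"
proof -
  let ?E = "\<chi> a i. e i $ a"
  have "x = 0" if "?E *v x = 0" for x
  proof -
    have "0 = L (\<Sum>i\<in>UNIV. x $ i *\<^sub>R e i) \<bullet> L (e j)" for j
      using that linear_0[OF assms(1)] by (simp add: columns_mult_vec)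
    also have "\<dots> j = (\<Sum>i\<in>UNIV. x $ i * (L (e i) \<bullet> L (e j)))" for j
      by (simp add: linear_sum[OF assms(1)] linear_cmul[OF assms(1)] inner_sum_left)
    also have "\<dots> j = x $ j" for j
      by (simp add: assms(2) if_distrib cong: if_cong)
    finally show ?thesis by (simp add: vec_eq_iff)
  qed
  then show ?thesis
    by (simp add: invertible_left_inverse matrix_left_invertible_ker)
qed

lemma basis_coordinates:
  fixes e :: "'n::finite \<Rightarrow> real^'n"
  assumes "invertible (\<chi> a i. e i $ a)"
  obtains c where "v = (\<Sum>i\<in>UNIV. c i *\<^sub>R e i)"
proof
  let ?E = "\<chi> a i. e i $ a"
  have "v = ?E *v (matrix_inv ?E *v v)"
    by (simp add: matrix_vector_mul_assoc invertible_matrix_inv[OF assms])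
  then show "v = (\<Sum>i\<in>UNIV. (matrix_inv ?E *v v) $ i *\<^sub>R e i)"
    by (simp only: columns_mult_vec)
qed

text \<open>Conjugation by the matrix of eigenvectors makes \<open>A\<close> diagonal without
  changing the trace. Sums over a possibly discontinuous frame thereby become traces of smooth
  matrices.\<close>

lemma trace_eigenbasis:
  fixes A :: "real^'n^'n" and e :: "'n::finite \<Rightarrow> real^'n"
  assumes "invertible (\<chi> a i. e i $ a)" "\<And>i. A *v e i = c i *\<^sub>R e i"
  shows "trace A = (\<Sum>i\<in>UNIV. c i)"
proof -
  let ?E = "\<chi> a i. e i $ a" and ?C = "\<chi> i j. if i = j then c j else 0"
  have "A ** ?E = ?E ** ?C"
  proof -
    have "(A ** ?E) $ a $ i = (?E ** ?C) $ a $ i" for a i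
    proof -
      have "(A ** ?E) $ a $ i = (A *v e i) $ a"
        by (simp add: matrix_matrix_mult_def matrix_vector_mult_def)
      also have "\<dots> = (?E ** ?C) $ a $ i"
        by (simp add: assms(2) matrix_matrix_mult_def if_distrib cong: if_cong)
      finally show ?thesis .
    qed
    then show ?thesis by (simp add: vec_eq_iff)
  qed
  then have "?E ** (?C ** matrix_inv ?E) = A ** (?E ** matrix_inv ?E)"
    by (simp only: matrix_mul_assoc)
  then have "A = ?E ** (?C ** matrix_inv ?E)"
    by (simp add: invertible_matrix_inv[OF assms(1)])
  then have "trace A = trace ((?C ** matrix_inv ?E) ** ?E)"
    using trace_mul_sym[of ?E "?C ** matrix_inv ?E"] by simp
  also have "\<dots> = trace ?C"
    by (simp add: invertible_matrix_inv[OF assms(1)] flip: matrix_mul_assoc)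
  finally show ?thesis by (simp add: trace_def)
qed

text \<open>The oriented sphere with centre \<open>c\<close> and radius \<open>s\<close> is encoded as \<open>(c, - s)\<close>; two
  spheres are in oriented contact iff their difference is null for this Lorentz form.\<close>

definition lorentz :: "'a::real_inner \<times> real \<Rightarrow> 'a \<times> real \<Rightarrow> real" where
  "lorentz X Y = fst X \<bullet> fst Y - snd X * snd Y"

lemma bounded_bilinear_lorentz: "bounded_bilinear (lorentz :: 'a::real_inner \<times> real \<Rightarrow> _)"
proof (rule bounded_bilinear.intro)
  show "\<exists>K. \<forall>X Y. norm (lorentz (X :: 'a \<times> real) Y) \<le> norm X * norm Y * K"
  proof (intro exI allI)
    fix X Y :: "'a \<times> real"
    have "norm (fst X) \<le> norm X" "norm (fst Y) \<le> norm Y" "norm (snd X) \<le> norm X" "norm (snd Y) \<le> norm Y"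
      by (metis norm_fst_le norm_snd_le prod.collapse)+
    then have "norm (fst X) * norm (fst Y) \<le> norm X * norm Y" "norm (snd X) * norm (snd Y) \<le> norm X * norm Y"
      by (auto intro!: mult_mono)
    moreover have "norm (lorentz X Y) \<le> norm (fst X) * norm (fst Y) + norm (snd X) * norm (snd Y)"
      unfolding lorentz_def
      using Cauchy_Schwarz_ineq2[of "fst X" "fst Y"] by (auto simp: abs_mult[symmetric])
    ultimately show "norm (lorentz X Y) \<le> norm X * norm Y * 2" by simp
  qed
qed (auto simp: lorentz_def algebra_simps inner_add_left inner_add_right)

interpretation lorentz: bounded_bilinear lorentz
  by (rule bounded_bilinear_lorentz)

lemmas dird_lorentz = dird_bilinear[OF bounded_bilinear_lorentz]

lemma lorentz_commute: "lorentz X Y = lorentz Y X"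
  by (simp add: lorentz_def inner_commute)

text \<open>The \<open>q i\<close> are orthonormal and orthogonal to \<open>N\<close> and
  \<open>Z\<close>, while \<open>\<langle>N, N\<rangle> = 0\<close>,
  \<open>\<langle>N, Z\<rangle> = 1\<close> and
  \<open>\<langle>Z, Z\<rangle> = 2 \<sigma> + E \<bullet> E - 1\<close>. The coefficients on the
  right are the entries of the inverse Gram matrix of this basis.\<close>

lemma lorentz_expand:
  fixes \<nu> :: "real^'m::finite" and t :: "'n::finite \<Rightarrow> real^'m"
  assumes frame: "CARD('m) = CARD('n) + 1" "norm \<nu> = 1" "\<And>i. \<nu> \<bullet> t i = 0"
    "\<And>i j. t i \<bullet> t j = (if i = j then 1 else 0)"
    and E: "E \<bullet> \<nu> = 0"
    and N: "N = (\<nu>, 1)" and Z: "Z = \<sigma> *\<^sub>R N - (E, 1)"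
    and q: "\<And>i. q i = (t i, 0) + (E \<bullet> t i) *\<^sub>R N"
  shows "lorentz X Y = (\<Sum>i\<in>UNIV. lorentz X (q i) * lorentz Y (q i)) +
    lorentz X N * lorentz Y Z + lorentz X Z * lorentz Y N
      - (2 * \<sigma> + E \<bullet> E - 1) * (lorentz X N * lorentz Y N)"
proof -
  obtain x s where X: "X = (x, s)" by fastforce
  obtain y s' where Y: "Y = (y, s')" by fastforce
  define a where "a = x \<bullet> \<nu> - s"
  define b where "b = y \<bullet> \<nu> - s'"
  have XN: "lorentz X N = a" "lorentz Y N = b"
    by (simp_all add: lorentz_def X Y N a_def b_def)
  have XZ: "lorentz X Z = \<sigma> * a - (x \<bullet> E - s)" "lorentz Y Z = \<sigma> * b - (y \<bullet> E - s')"
    by (simp_all add: lorentz_def X Y N Z a_def b_def inner_diff_right algebra_simps)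
  have Xq: "lorentz X (q i) = x \<bullet> t i + (E \<bullet> t i) * a" "lorentz Y (q i) = y \<bullet> t i + (E \<bullet> t i) * b" for i
    by (simp_all add: lorentz_def X Y N q a_def b_def inner_add_right algebra_simps)
  have xy: "x \<bullet> y = (a + s) * (b + s') + (\<Sum>i\<in>UNIV. (x \<bullet> t i) * (y \<bullet> t i))"
    using orthonormal_frame_inner[OF frame, of x y] by (simp add: a_def b_def)
  have xE: "x \<bullet> E = (\<Sum>i\<in>UNIV. (x \<bullet> t i) * (E \<bullet> t i))" for x
    using orthonormal_frame_inner[OF frame, of x E] E by simp
  have "(\<Sum>i\<in>UNIV. lorentz X (q i) * lorentz Y (q i)) =
      (\<Sum>i\<in>UNIV. (x \<bullet> t i) * (y \<bullet> t i) + b * ((x \<bullet> t i) * (E \<bullet> t i)) + a * ((y \<bullet> t i) * (E \<bullet> t i))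
        + (a * b) * ((E \<bullet> t i) * (E \<bullet> t i)))"
    by (rule sum.cong) (auto simp: Xq algebra_simps)
  also have "\<dots> = (\<Sum>i\<in>UNIV. (x \<bullet> t i) * (y \<bullet> t i)) + b * (x \<bullet> E) + a * (y \<bullet> E) + (a * b) * (E \<bullet> E)"
    by (simp add: sum.distrib xE[of x] xE[of y] xE[of E] sum_distrib_left)
  finally show ?thesis
    by (simp add: XN XZ) (simp add: lorentz_def X Y xy algebra_simps)
qed

section \<open>Hypersurfaces with two principal curvatures\<close>

text \<open>The sum of the cubes determines the two values and itself has only finitely many possible
  values; being continuous, it is constant.\<close>

lemma two_values_cubic:
  fixes b :: "'n::finite \<Rightarrow> real"
  assumes "(\<Sum>i\<in>UNIV. b i) = 0" "(\<Sum>i\<in>UNIV. (b i)\<^sup>2) = 1" "range b = {p, q}"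
  shows "p * q = - 1 / CARD('n)" "(\<Sum>i\<in>UNIV. (b i)^3) = p + q"
proof -
  \<comment> \<open>Both values are roots of one quadratic. Summing it gives the product
    \<open>p * q\<close>; summing its multiple by \<open>b i\<close> gives the cubes.\<close>
  have sq: "(b i)\<^sup>2 = (p + q) * b i - p * q" for i
  proof -
    have "b i \<in> {p, q}" using assms(3) by blast
    then show ?thesis by (auto simp: power2_eq_square algebra_simps)
  qed
  have "1 = (\<Sum>i\<in>UNIV. (p + q) * b i - p * q)"
    using assms(2) by (simp add: sq)
  also have "\<dots> = - CARD('n) * (p * q)"
    using assms(1) by (simp add: sum_subtractf flip: sum_distrib_left)
  finally show "p * q = - 1 / CARD('n)" by (simp add: field_simps)
  have cube: "(b i)^3 = (p + q) * (b i)\<^sup>2 - (p * q) * b i" for i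
    using arg_cong[OF sq[of i], of "\<lambda>z. b i * z"]
    by (simp add: power3_eq_cube power2_eq_square algebra_simps)
  show "(\<Sum>i\<in>UNIV. (b i)^3) = p + q"
    using assms(1,2) by (simp add: cube sum_subtractf flip: sum_distrib_left)
qed

text \<open>If \<open>p\<close> has multiplicity \<open>m\<close>, then the vanishing sum and
  \<open>p q = - 1 / n\<close> give \<open>p\<^sup>2 = (n - m) / (m n)\<close>. So \<open>m\<close>
  and the sign \<open>s\<close> of \<open>p\<close> determine \<open>p\<close>, then
  \<open>q = - 1 / (n p)\<close>, and then the sum of cubes \<open>p + q\<close>.\<close>

lemma two_values_finitely_many:
  "finite {t. \<exists>b :: 'n::finite \<Rightarrow> real. (\<Sum>i\<in>UNIV. b i) = 0 \<and> (\<Sum>i\<in>UNIV. (b i)\<^sup>2) = 1 \<and>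
    card (range b) = 2 \<and> t = (\<Sum>i\<in>UNIV. (b i)^3)}" (is "finite ?T")
proof -
  let ?n = "real CARD('n)"
  let ?P = "\<lambda>m. sqrt ((?n - m) / (m * ?n))"
  let ?f = "\<lambda>(m::nat, s). s * ?P m - 1 / (?n * (s * ?P m))"
  have "?T \<subseteq> ?f ` ({..CARD('n)} \<times> {1, -1})"
  proof
    fix t assume "t \<in> ?T"
    then obtain b :: "'n \<Rightarrow> real" where b: "(\<Sum>i\<in>UNIV. b i) = 0" "(\<Sum>i\<in>UNIV. (b i)\<^sup>2) = 1"
      "card (range b) = 2" "t = (\<Sum>i\<in>UNIV. (b i)^3)" by blast
    then obtain p q where pq: "range b = {p, q}" "p \<noteq> q" by (meson card_2_iff)
    note pq1 = two_values_cubic[OF b(1,2) pq(1)]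
    define m where "m = card {i. b i = p}"
    have mn: "m \<le> CARD('n)" by (simp add: m_def card_mono)
    have m: "m > 0"
      using pq(1) by (auto simp: m_def card_gt_0_iff) (metis insertI1 rangeE)
    have split: "b i = (if b i = p then p else q)" for i
      using pq(1) by auto
    have "0 = (\<Sum>i\<in>UNIV. if b i = p then p else q)"
      using b(1) split by simp
    also have "\<dots> = m * p + card {i. b i \<noteq> p} * q"
      by (simp add: sum.If_cases m_def Compl_eq)
    also have "card {i. b i \<noteq> p} = CARD('n) - m"
      unfolding m_def by (subst card_Diff_subset[symmetric]) (auto intro: arg_cong[where f = card])
    finally have 0: "m * p + (?n - m) * q = 0" using mn by (simp add: of_nat_diff)
    have p: "p \<noteq> 0" using pq1(1) by auto
    have q: "q = - 1 / (?n * p)" using pq1(1) p by (simp add: field_simps)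
    have "m * p\<^sup>2 = - (?n - m) * (p * q)"
      using arg_cong[OF 0, of "\<lambda>z. z * p"] by (simp add: power2_eq_square algebra_simps)
    then have "p\<^sup>2 = (?n - m) / (m * ?n)"
      using m pq1(1) by (simp add: field_simps)
    then have "\<bar>p\<bar> = ?P m" by (metis real_sqrt_abs)
    then obtain s where s: "s \<in> {1, -1}" "p = s * ?P m"
      by (metis abs_if insertCI minus_minus mult_1 mult_minus_left)
    have "t = ?f (m, s)"
      using b(4) pq1(2) q unfolding s(2)[symmetric] by (simp add: s(2)[symmetric])
    then show "t \<in> ?f ` ({..CARD('n)} \<times> {1, -1})"
      using s(1) mn by blast
  qed
  then show ?thesis by (rule finite_subset) auto
qed

text \<open>The situation to be excluded for positive \<open>lam\<close>, read in one chart.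
  Connectedness of \<open>D\<close> will make the normalised eigenvalues constant.\<close>

locale two_curvature_hypersurface =
  fixes D :: "(real^'n::finite) set" and y \<nu> :: "real^'n \<Rightarrow> real^'m::finite"
    and e :: "'n \<Rightarrow> real^'n \<Rightarrow> real^'n" and k :: "'n \<Rightarrow> real^'n \<Rightarrow> real" and lam :: real
  assumes codim: "CARD('m) = CARD('n) + 1"
    and D: "open D" and conn: "connected D"
    and hyp: "local_hypersurface D y \<nu>"
    and frame: "principal_frame D y \<nu> e k"
    and k_nz: "\<And>u i. u \<in> D \<Longrightarrow> k i u \<noteq> 0"
    and two: "\<And>u. u \<in> D \<Longrightarrow> card (range (\<lambda>i. k i u)) = 2"
    and form: "\<And>u v. u \<in> D \<Longrightarrow> laguerre_form \<nu> e k u v = 0"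
    and tens: "\<And>u i j. u \<in> D \<Longrightarrow> laguerre_tensor_coeff \<nu> e k i j u = (if i = j then lam else 0)"
begin

lemma y_smooth: "smooth_on y D" and nu_smooth: "smooth_on \<nu> D"
  using hyp by (auto simp: local_hypersurface_def)

lemma differentiableD: "smooth_on f D \<Longrightarrow> u \<in> D \<Longrightarrow> f differentiable (at u)"
  by (rule smooth_on_differentiable)

lemma dird_commute': "smooth_on (f :: _ \<Rightarrow> 'b::real_inner) D \<Longrightarrow> u \<in> D \<Longrightarrow> dird v (dird w f) u = dird w (dird v f) u"
  by (rule dird_commute[OF D])

definition t :: "'n \<Rightarrow> real^'n \<Rightarrow> real^'m" where
  "t i u = dird (e i u) y u"

lemma t_orth: "u \<in> D \<Longrightarrow> t i u \<bullet> t j u = (if i = j then 1 else 0)"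
  using frame by (simp add: principal_frame_def t_def)

lemma dnu_e: "u \<in> D \<Longrightarrow> dird (e i u) \<nu> u = - k i u *\<^sub>R t i u"
  using frame by (simp add: principal_frame_def principal_direction_def t_def)

lemma nu_norm: "u \<in> D \<Longrightarrow> norm (\<nu> u) = 1"
  using hyp by (simp add: local_hypersurface_def)

lemma nu_dy: "u \<in> D \<Longrightarrow> \<nu> u \<bullet> dird v y u = 0"
  using hyp by (simp add: local_hypersurface_def)

lemma nu_t: "u \<in> D \<Longrightarrow> \<nu> u \<bullet> t i u = 0"
  by (simp add: t_def nu_dy)

lemma e_invertible: "u \<in> D \<Longrightarrow> invertible (\<chi> a i. e i u $ a)"
  using orthonormal_image_basis[OF smooth_on_linear_dird[OF y_smooth]] t_orth
  by (simp add: t_def)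

text \<open>Linear identities at a point need checking only on the principal vectors there, which
  asks nothing of how the frame varies.\<close>

lemma frame_ext:
  fixes L L' :: "real^'n \<Rightarrow> 'b::real_vector"
  assumes "u \<in> D" "linear L" "linear L'" "\<And>i. L (e i u) = L' (e i u)"
  shows "L v = L' v"
proof -
  obtain c where "v = (\<Sum>i\<in>UNIV. c i *\<^sub>R e i u)"
    using basis_coordinates[OF e_invertible[OF assms(1)]] .
  then show ?thesis
    using assms(4) by (simp add: linear_sum[OF assms(2)] linear_sum[OF assms(3)]
      linear_cmul[OF assms(2)] linear_cmul[OF assms(3)])
qed

lemma linear_dird: "smooth_on f D \<Longrightarrow> u \<in> D \<Longrightarrow> linear (\<lambda>v. dird v f u)"
  by (rule smooth_on_linear_dird)

lemma nu_dnu: "u \<in> D \<Longrightarrow> \<nu> u \<bullet> dird v \<nu> u = 0"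
  by (rule frame_ext[where L' = "\<lambda>_. 0" and L = "\<lambda>v. \<nu> u \<bullet> dird v \<nu> u"])
    (auto simp: dnu_e nu_t intro!: linear_compose[OF linear_dird[OF nu_smooth], unfolded o_def]
      bounded_linear.linear[OF bounded_linear_inner_right] linear_zero)

text \<open>In the principal frame \<open>d\<nu>\<close> is diagonal with entries
  \<open>- k i\<close>, and none of these vanishes.\<close>

lemma dnu_inj:
  assumes "u \<in> D" "dird v \<nu> u = 0"
  shows "v = 0"
proof -
  obtain c where v: "v = (\<Sum>i\<in>UNIV. c i *\<^sub>R e i u)"
    using basis_coordinates[OF e_invertible[OF assms(1)]] .
  have "0 = (\<Sum>i\<in>UNIV. - (c i * k i u) *\<^sub>R t i u) \<bullet> t j u" for j
    using assms(2) unfolding v linear_sum[OF linear_dird[OF nu_smooth assms(1)]]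
      linear_cmul[OF linear_dird[OF nu_smooth assms(1)]]
    by (simp add: dnu_e[OF assms(1)])
  also have "\<dots> j = - (c j * k j u)" for j
    by (simp add: inner_sum_left t_orth[OF assms(1)] if_distrib sum_negf cong: if_cong)
  finally have "c j = 0" for j using k_nz[OF assms(1)] by simp
  then show ?thesis by (simp add: v)
qed

section \<open>The third fundamental form\<close>

abbreviation G :: "real^'n \<Rightarrow> real^'n^'n" where "G \<equiv> third_form \<nu>"

lemma G_mult:
  assumes "u \<in> D"
  shows "(G u *v w) $ i = dird (axis i 1) \<nu> u \<bullet> dird w \<nu> u"
  unfolding dird_axis_expand[OF differentiableD[OF nu_smooth assms], of w]
  by (simp add: third_form_def matrix_vector_mult_def inner_sum_right mult.commute)

lemma G_inner:
  assumes "u \<in> D"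
  shows "v \<bullet> (G u *v w) = dird v \<nu> u \<bullet> dird w \<nu> u"
proof -
  have "v \<bullet> (G u *v w) = (\<Sum>i\<in>UNIV. v $ i * (dird (axis i 1) \<nu> u \<bullet> dird w \<nu> u))"
    by (simp add: inner_vec_def G_mult[OF assms])
  also have "\<dots> = dird v \<nu> u \<bullet> dird w \<nu> u"
    unfolding dird_axis_expand[OF differentiableD[OF nu_smooth assms], of v] by (simp add: inner_sum_left)
  finally show ?thesis .
qed

lemma G_invertible:
  assumes "u \<in> D"
  shows "invertible (G u)"
proof -
  have "w = 0" if "G u *v w = 0" for w
    using G_inner[OF assms, of w w] that dnu_inj[OF assms] by simp
  then show ?thesis
    by (simp add: invertible_left_inverse matrix_left_invertible_ker)
qed

lemma G_smooth: "smooth_on (\<lambda>u. G u $ i $ j) D"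
  unfolding third_form_def by (simp add: smooth_on_inner D smooth_on_dird nu_smooth)

abbreviation Gi :: "real^'n \<Rightarrow> real^'n^'n" where "Gi u \<equiv> matrix_inv (G u)"

lemma Gi_smooth: "smooth_on (\<lambda>u. Gi u $ i $ j) D"
  by (rule smooth_on_matrix_inv[OF D G_smooth G_invertible])

text \<open>The matrix of \<open>dy\<close> in terms of \<open>d\<nu>\<close>.\<close>

definition B :: "real^'n \<Rightarrow> real^'n^'n" where
  "B u = Gi u ** (\<chi> i j. dird (axis i 1) \<nu> u \<bullet> dird (axis j 1) y u)"

lemma B_smooth: "smooth_on (\<lambda>u. B u $ i $ j) D"
  unfolding B_def matrix_matrix_mult_def
  by (simp add: smooth_on_sum smooth_on_mult smooth_on_inner D Gi_smooth smooth_on_dird nu_smooth y_smooth)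

lemma dy_e: "u \<in> D \<Longrightarrow> t i u = - radius k i u *\<^sub>R dird (e i u) \<nu> u"
  using k_nz by (simp add: dnu_e radius_def)

text \<open>On \<open>e i\<close> the differential \<open>dy\<close> is \<open>- radius k i\<close>
  times \<open>d\<nu>\<close>, so the matrix of mixed products acts there as that multiple of
  \<open>G\<close>, and \<open>Gi\<close> cancels \<open>G\<close>.\<close>

lemma B_e:
  assumes "u \<in> D"
  shows "B u *v e i u = - radius k i u *\<^sub>R e i u"
proof -
  let ?H = "\<chi> i j. dird (axis i 1) \<nu> u \<bullet> dird (axis j 1) y u"
  have "(?H *v e i u) $ l = dird (axis l 1) \<nu> u \<bullet> t i u" for l
    unfolding t_def dird_axis_expand[OF differentiableD[OF y_smooth assms], of "e i u"]
    by (simp add: matrix_vector_mult_def inner_sum_right mult.commute)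
  then have "?H *v e i u = - radius k i u *\<^sub>R (G u *v e i u)"
    by (subst vec_eq_iff) (simp add: G_mult[OF assms] dy_e[OF assms])
  then have "B u *v e i u = - radius k i u *\<^sub>R (Gi u *v (G u *v e i u))"
    unfolding B_def matrix_vector_mul_assoc[symmetric] by (simp only: matrix_vector_mult_scaleR)
  then show ?thesis
    by (simp add: matrix_vector_mul_assoc invertible_matrix_inv[OF G_invertible[OF assms]])
qed

section \<open>Smoothness of the mean radius and of \<rho>\<close>

lemma mean_radius_trace:
  assumes "u \<in> D"
  shows "mean_radius k u = - (1 / CARD('n)) * trace (B u)"
  using trace_eigenbasis[OF e_invertible[OF assms], of "B u" "\<lambda>i. - radius k i u"] B_e[OF assms]
  by (simp add: mean_radius_def sum_negf)

lemma mean_smooth: "smooth_on (mean_radius k) D"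
proof (rule smooth_on_cong[OF D])
  show "- (1 / CARD('n)) * trace (B u) = mean_radius k u" if "u \<in> D" for u
    using mean_radius_trace[OF that] by simp
  show "smooth_on (\<lambda>u. - (1 / CARD('n)) * trace (B u)) D"
    unfolding trace_def by (intro smooth_on_mult smooth_on_const smooth_on_sum D B_smooth)
qed

text \<open>The trace-free part of \<open>B\<close>. It is smooth although its eigenvectors
  \<open>e i\<close> may be chosen discontinuously.\<close>

definition S :: "real^'n \<Rightarrow> real^'n^'n" where
  "S u = B u + mean_radius k u *\<^sub>R mat 1"

lemma S_smooth: "smooth_on (\<lambda>u. S u $ i $ j) D"
  unfolding S_def
  by (simp add: smooth_on_add smooth_on_mult D B_smooth mean_smooth smooth_on_const)

lemma S_e:
  assumes "u \<in> D"
  shows "S u *v e i u = (mean_radius k u - radius k i u) *\<^sub>R e i u"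
  using B_e[OF assms] by (simp add: S_def matrix_vector_mult_add_rdistrib scaleR_matrix_vector_assoc[symmetric] algebra_simps)

lemma rho_trace:
  assumes "u \<in> D"
  shows "(\<Sum>i\<in>UNIV. (mean_radius k u - radius k i u)\<^sup>2) = trace (S u ** S u)"
  by (rule trace_eigenbasis[OF e_invertible[OF assms], symmetric])
    (simp add: matrix_vector_mul_assoc[symmetric] S_e[OF assms] matrix_vector_mult_scaleR power2_eq_square)

lemma cube_trace:
  assumes "u \<in> D"
  shows "(\<Sum>i\<in>UNIV. (mean_radius k u - radius k i u)^3) = trace (S u ** (S u ** S u))"
  by (rule trace_eigenbasis[OF e_invertible[OF assms], symmetric])
    (simp add: matrix_vector_mul_assoc[symmetric] S_e[OF assms] matrix_vector_mult_scaleR power3_eq_cube mult.assoc)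

text \<open>A vanishing sum would make all radii equal, hence leave only one principal
  curvature.\<close>

lemma rho_sum_pos:
  assumes "u \<in> D"
  shows "(\<Sum>i\<in>UNIV. (mean_radius k u - radius k i u)\<^sup>2) > 0"
proof (rule ccontr)
  assume "\<not> ?thesis"
  then have "(\<Sum>i\<in>UNIV. (mean_radius k u - radius k i u)\<^sup>2) = 0"
    by (simp add: antisym sum_nonneg not_less)
  then have "radius k i u = mean_radius k u" for i
    by (simp add: sum_nonneg_eq_0_iff)
  then have "k i u = 1 / mean_radius k u" for i
    by (metis div_by_1 divide_divide_eq_right mult_1 radius_def)
  then have "range (\<lambda>i. k i u) \<subseteq> {1 / mean_radius k u}" by blast
  then have "card (range (\<lambda>i. k i u)) \<le> 1"
    by (metis card.empty card.insert card_mono empty_iff finite.emptyI finite_insert One_nat_def)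
  then show False using two[OF assms] by simp
qed

lemma rho_pos: "u \<in> D \<Longrightarrow> rho k u > 0"
  using rho_sum_pos by (simp add: rho_def)

lemma rho_nz: "u \<in> D \<Longrightarrow> rho k u \<noteq> 0"
  using rho_pos by force

lemma rho_smooth: "smooth_on (rho k) D"
proof (rule smooth_on_cong[OF D])
  show "sqrt (trace (S u ** S u)) = rho k u" if "u \<in> D" for u
    using rho_trace[OF that] by (simp add: rho_def)
  show "smooth_on (\<lambda>u. sqrt (trace (S u ** S u))) D"
  proof (rule smooth_on_sqrt[OF D])
    show "smooth_on (\<lambda>u. trace (S u ** S u)) D"
      unfolding trace_def matrix_matrix_mult_def
      by (simp add: smooth_on_mult smooth_on_sum D S_smooth)
  qed (use rho_trace rho_sum_pos in simp)
qed

section \<open>The eigenvalues of \<open>S\<close> divided by \<rho>, and their constancy\<close>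

definition b :: "'n \<Rightarrow> real^'n \<Rightarrow> real" where
  "b i u = (mean_radius k u - radius k i u) / rho k u"

lemma b_sum: "(\<Sum>i\<in>UNIV. b i u) = 0"
  by (simp add: b_def mean_radius_def sum_subtractf flip: sum_divide_distrib)

lemma b_sum_sq: "u \<in> D \<Longrightarrow> (\<Sum>i\<in>UNIV. (b i u)\<^sup>2) = 1"
  using rho_sum_pos[of u]
  by (simp add: b_def power_divide rho_def flip: sum_divide_distrib)

lemma b_range:
  assumes "u \<in> D"
  shows "card (range (\<lambda>i. b i u)) = 2"
proof -
  have "range (\<lambda>i. b i u) = (\<lambda>\<kappa>. (mean_radius k u - 1 / \<kappa>) / rho k u) ` range (\<lambda>i. k i u)"
    by (auto simp: b_def radius_def)
  moreover have "inj (\<lambda>\<kappa>. (mean_radius k u - 1 / \<kappa>) / rho k u)"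
    using rho_pos[OF assms] by (auto simp: inj_def)
  ultimately show ?thesis
    using two[OF assms] by (metis card_image inj_on_subset subset_UNIV)
qed

text \<open>The sum is the trace of the cube of \<open>S\<close>, divided by the cube of \<rho>,
  hence continuous; it takes finitely many values on a connected set.\<close>

lemma b_cubes_constant: "(\<lambda>u. \<Sum>i\<in>UNIV. (b i u)^3) constant_on D"
proof (rule continuous_finite_range_constant[OF conn])
  have "smooth_on (\<lambda>u. trace (S u ** (S u ** S u)) * inverse (rho k u * (rho k u * rho k u))) D"
    unfolding trace_def matrix_matrix_mult_def
    by (intro smooth_on_mult smooth_on_inverse D rho_smooth)
      (use rho_nz in \<open>auto simp: smooth_on_mult smooth_on_sum D S_smooth\<close>)
  then have "smooth_on (\<lambda>u. \<Sum>i\<in>UNIV. (b i u)^3) D"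
    by (rule smooth_on_cong[OF D, rotated])
      (simp add: b_def power_divide cube_trace[symmetric] power3_eq_cube divide_inverse sum_distrib_left mult_ac)
  then show "continuous_on D (\<lambda>u. \<Sum>i\<in>UNIV. (b i u)^3)"
    by (rule smooth_on_continuous)
  show "finite ((\<lambda>u. \<Sum>i\<in>UNIV. (b i u)^3) ` D)"
    by (rule finite_subset[OF _ two_values_finitely_many[where 'n = 'n]])
      (use b_sum b_sum_sq b_range in blast)
qed

lemma two_constant_values:
  obtains p q where "p > q" "\<And>u. u \<in> D \<Longrightarrow> range (\<lambda>i. b i u) = {p, q}"
proof -
  obtain \<tau> where tau: "\<And>u. u \<in> D \<Longrightarrow> (\<Sum>i\<in>UNIV. (b i u)^3) = \<tau>"
    using b_cubes_constant by (auto simp: constant_on_def)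
  \<comment> \<open>The square root of the discriminant of
    \<open>x\<^sup>2 - \<tau> x - 1 / n\<close>, whose roots are the two eigenvalues.\<close>
  define w where "w = sqrt (\<tau>\<^sup>2 + 4 / CARD('n))"
  have w: "w > 0" by (simp add: w_def add_nonneg_pos)
  show ?thesis
  proof
    show "(\<tau> + w) / 2 > (\<tau> - w) / 2" using w by simp
    fix u assume u: "u \<in> D"
    obtain p q where pq: "range (\<lambda>i. b i u) = {p, q}" "p \<noteq> q"
      using b_range[OF u] by (meson card_2_iff)
    have *: "{p, q} = {(\<tau> + w) / 2, (\<tau> - w) / 2}"
      if "p * q = - 1 / CARD('n)" "p + q = \<tau>" "p > q" for p q :: real
    proof -
      have "(p - q)\<^sup>2 = \<tau>\<^sup>2 + 4 / CARD('n)"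
        using that(1) unfolding that(2)[symmetric] by (simp add: power2_eq_square algebra_simps)
      then have "p - q = w" unfolding w_def using that(3) by (metis diff_gt_0_iff_gt less_imp_le real_sqrt_unique)
      then show ?thesis using that(2) by force
    qed
    have pq': "p * q = - 1 / CARD('n)" "p + q = \<tau>"
      using two_values_cubic[OF b_sum b_sum_sq[OF u] pq(1)] tau[OF u] by auto
    show "range (\<lambda>i. b i u) = {(\<tau> + w) / 2, (\<tau> - w) / 2}"
    proof (cases "p > q")
      case True
      then show ?thesis using *[OF pq'] pq(1) by simp
    next
      case False
      then show ?thesis using *[of q p] pq' pq by (simp add: mult.commute add.commute insert_commute)
    qed
  qed
qed

end

section \<open>The two families of curvature spheres\<close>

lemma linear_componentI: "linear L \<Longrightarrow> bounded_linear (g :: _ \<Rightarrow> 'c::real_normed_vector) \<Longrightarrow> linear (\<lambda>v. g (L v))"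
  using linear_compose[of L g] bounded_linear.linear[of g] by (simp add: o_def)

locale two_valued_hypersurface = two_curvature_hypersurface D y \<nu> e k lam
  for D :: "(real^'n::finite) set" and y \<nu> :: "real^'n \<Rightarrow> real^'m::finite" and e k lam +
  fixes p q :: real
  assumes pq: "p > q" and b_values: "\<And>u. u \<in> D \<Longrightarrow> range (\<lambda>i. b i u) = {p, q}"
begin

abbreviation f :: "real^'n \<Rightarrow> real" where "f \<equiv> log_rho k"

lemma f_smooth: "smooth_on f D"
  unfolding log_rho_def using smooth_on_ln[OF D rho_smooth rho_pos] by (simp add: log_rho_def[abs_def])

lemma drho: "u \<in> D \<Longrightarrow> dird v (rho k) u = rho k u * dird v f u"
proof -
  assume u: "u \<in> D"
  have "dird v f u = inverse (rho k u) * dird v (rho k) u"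
    unfolding log_rho_def[abs_def]
    using dird_eqI[OF has_derivative_ln[OF rho_pos[OF u] smooth_on_has_derivative[OF rho_smooth u]]]
    by (simp add: divide_inverse mult.commute)
  then show ?thesis using rho_nz[OF u] by simp
qed

text \<open>The Laguerre form evaluated on the \<open>j\<close>-th vector of the Laguerre frame is
  its \<open>j\<close>-th coefficient; setting it to zero and solving gives the derivative of the
  mean radius.\<close>

lemma dmean_e:
  assumes u: "u \<in> D"
  shows "dird (e j u) (mean_radius k) u = b j u * (rho k u * dird (e j u) f u)"
proof -
  have coframe: "laguerre_coframe \<nu> e k i u (laguerre_frame e k j u) = (if i = j then 1 else 0)" for i
  proof -
    have "laguerre_coframe \<nu> e k i u (laguerre_frame e k j u) =
        radius k i u * radius k j u * (dird (e i u) \<nu> u \<bullet> dird (e j u) \<nu> u)"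
      using rho_nz[OF u]
      by (simp add: laguerre_coframe_def laguerre_metric_def laguerre_frame_def G_inner[OF u]
          linear_cmul[OF linear_dird[OF nu_smooth u]] power2_eq_square)
    then show ?thesis
      using k_nz[OF u] by (simp add: dnu_e[OF u] t_orth[OF u] radius_def)
  qed
  have "laguerre_form_coeff e k j u = laguerre_form \<nu> e k u (laguerre_frame e k j u)"
    by (simp add: laguerre_form_def coframe if_distrib cong: if_cong)
  then have "laguerre_form_coeff e k j u = 0" using form[OF u] by simp
  then show ?thesis
    using rho_nz[OF u] k_nz[OF u] by (simp add: laguerre_form_coeff_def b_def radius_def)
qed

text \<open>The gradient of \<open>log \<rho>\<close> for the third fundamental form, pushed into
  the ambient space by \<open>d\<nu>\<close>. The coordinate sum makes its smoothness
  visible.\<close>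

definition E :: "real^'n \<Rightarrow> real^'m" where
  "E u = (\<Sum>l\<in>UNIV. gradient G f u $ l *\<^sub>R dird (axis l 1) \<nu> u)"

lemma E_dird: "u \<in> D \<Longrightarrow> E u = dird (gradient G f u) \<nu> u"
  unfolding E_def by (rule dird_axis_expand[OF differentiableD[OF nu_smooth], symmetric])

lemma gradient_component: "gradient G f u $ l = (\<Sum>j\<in>UNIV. Gi u $ l $ j * dird (axis j 1) f u)"
  by (simp add: gradient_def matrix_vector_mult_def partial_def)

lemma E_smooth: "smooth_on E D"
  unfolding E_def[abs_def] gradient_component
  by (intro smooth_on_sum smooth_on_scaleR smooth_on_mult D Gi_smooth smooth_on_dird f_smooth nu_smooth)

lemma E_dnu:
  assumes u: "u \<in> D"
  shows "E u \<bullet> dird v \<nu> u = dird v f u"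
proof -
  have "E u \<bullet> dird v \<nu> u = v \<bullet> (G u *v gradient G f u)"
    by (simp add: E_dird[OF u] G_inner[OF u] inner_commute)
  also have "\<dots> = v \<bullet> (\<chi> i. dird (axis i 1) f u)"
    by (simp add: gradient_def matrix_vector_mul_assoc invertible_matrix_inv[OF G_invertible[OF u]] partial_def)
  also have "\<dots> = dird v f u"
    by (subst dird_axis_expand[OF differentiableD[OF f_smooth u], of v]) (simp add: inner_vec_def)
  finally show ?thesis .
qed

lemma E_nu: "u \<in> D \<Longrightarrow> E u \<bullet> \<nu> u = 0"
  by (simp add: E_dird nu_dnu inner_commute)

lemma gradient_norm: "u \<in> D \<Longrightarrow> gradient_norm_sq G f u = E u \<bullet> E u"
  by (simp add: gradient_norm_sq_def G_inner E_dird)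

lemma dE_nu:
  assumes u: "u \<in> D"
  shows "dird w E u \<bullet> \<nu> u = - dird w f u"
proof -
  have "dird w (\<lambda>u. E u \<bullet> \<nu> u) u = dird w (\<lambda>u. 0) u"
    by (rule dird_cong[OF D u]) (simp_all add: E_nu differentiableD[OF smooth_on_inner[OF D E_smooth nu_smooth] u])
  then show ?thesis
    by (simp add: dird_inner differentiableD[OF _ u] E_smooth nu_smooth E_dnu[OF u])
qed

lemma dE_dnu:
  assumes u: "u \<in> D"
  shows "dird w E u \<bullet> dird v \<nu> u = dird w (dird v f) u - dird w (dird v \<nu>) u \<bullet> E u"
proof -
  have "dird w (\<lambda>u. E u \<bullet> dird v \<nu> u) u = dird w (dird v f) u"
    by (rule dird_cong[OF D u])
      (simp_all add: E_dnu differentiableD[OF smooth_on_inner[OF D E_smooth smooth_on_dird[OF nu_smooth]] u])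
  then show ?thesis
    by (simp add: dird_inner differentiableD[OF _ u] E_smooth smooth_on_dird nu_smooth inner_commute)
qed

section \<open>The Hessian for the third fundamental form in ambient terms\<close>

lemma Gi_sym:
  assumes u: "u \<in> D"
  shows "Gi u $ i $ j = Gi u $ j $ i"
proof -
  have G: "transpose (G u) = G u"
    by (simp add: transpose_def third_form_def inner_commute vec_eq_iff)
  note inv = invertible_matrix_inv[OF G_invertible[OF u]]
  have "transpose (Gi u) ** G u = mat 1"
    using arg_cong[OF conjunct1[OF inv], of transpose] by (simp add: matrix_transpose_mul G transpose_mat)
  then have "transpose (Gi u) ** (G u ** Gi u) = Gi u"
    by (simp only: matrix_mul_assoc matrix_mul_lid)
  then have "transpose (Gi u) = Gi u"
    using inv by simp
  from arg_cong[OF this, of "\<lambda>A. A $ i $ j"] show ?thesis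
    by (simp add: transpose_def)
qed

lemma dG:
  assumes u: "u \<in> D"
  shows "partial i (\<lambda>w. G w $ j $ l) u =
    dird (axis i 1) (dird (axis j 1) \<nu>) u \<bullet> dird (axis l 1) \<nu> u
    + dird (axis j 1) \<nu> u \<bullet> dird (axis i 1) (dird (axis l 1) \<nu>) u"
  unfolding partial_def third_form_def
  by (simp add: dird_inner differentiableD[OF _ u] smooth_on_dird nu_smooth)

text \<open>The metric is induced by \<nu>. After the second derivatives of \<nu> are commuted, four
  of the six terms of the Christoffel symbol cancel and the other two coincide.\<close>

lemma christoffel_nu:
  assumes u: "u \<in> D"
  shows "christoffel G u c i j =
    (\<Sum>l\<in>UNIV. Gi u $ c $ l * (dird (axis i 1) (dird (axis j 1) \<nu>) u \<bullet> dird (axis l 1) \<nu> u))"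
  unfolding christoffel_def dG[OF u] sum_distrib_left
proof (rule sum.cong)
  fix l :: 'n
  show "1 / 2 * (Gi u $ c $ l *
      (dird (axis i 1) (dird (axis j 1) \<nu>) u \<bullet> dird (axis l 1) \<nu> u +
       dird (axis j 1) \<nu> u \<bullet> dird (axis i 1) (dird (axis l 1) \<nu>) u +
       (dird (axis j 1) (dird (axis i 1) \<nu>) u \<bullet> dird (axis l 1) \<nu> u +
        dird (axis i 1) \<nu> u \<bullet> dird (axis j 1) (dird (axis l 1) \<nu>) u) -
       (dird (axis l 1) (dird (axis i 1) \<nu>) u \<bullet> dird (axis j 1) \<nu> u +
        dird (axis i 1) \<nu> u \<bullet> dird (axis l 1) (dird (axis j 1) \<nu>) u))) =
    Gi u $ c $ l * (dird (axis i 1) (dird (axis j 1) \<nu>) u \<bullet> dird (axis l 1) \<nu> u)"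
    using dird_commute'[OF nu_smooth u, of "axis j 1" "axis i 1"]
      dird_commute'[OF nu_smooth u, of "axis l 1" "axis i 1"]
      dird_commute'[OF nu_smooth u, of "axis l 1" "axis j 1"]
    by (simp add: inner_commute)
qed simp

lemma dird2_axis_expand:
  fixes g :: "real^'n \<Rightarrow> 'b::real_inner"
  assumes g: "smooth_on g D" and u: "u \<in> D"
  shows "dird v (dird w g) u = (\<Sum>i\<in>UNIV. \<Sum>j\<in>UNIV. (v $ i * w $ j) *\<^sub>R dird (axis i 1) (dird (axis j 1) g) u)"
proof -
  have "dird v (dird w g) u = (\<Sum>i\<in>UNIV. v $ i *\<^sub>R dird w (dird (axis i 1) g) u)"
    by (subst dird_axis_expand[OF differentiableD[OF smooth_on_dird[OF g] u]]) (simp add: dird_commute'[OF g u, of _ w])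
  also have "\<dots> = (\<Sum>i\<in>UNIV. \<Sum>j\<in>UNIV. (v $ i * w $ j) *\<^sub>R dird (axis j 1) (dird (axis i 1) g) u)"
    by (rule sum.cong[OF refl])
      (simp add: dird_axis_expand[OF differentiableD[OF smooth_on_dird[OF g] u], of "axis i 1" w for i] scaleR_sum_right)
  finally show ?thesis
    by (simp add: dird_commute'[OF g u])
qed

text \<open>The Christoffel correction is the product of \<open>E\<close> with the second derivative
  of \<nu>, which is exactly what separates the second derivative of \<open>f\<close> from
  \<open>dE \<bullet> d\<nu>\<close> in \<open>dE_dnu\<close>.\<close>

lemma hessian_E:
  assumes u: "u \<in> D"
  shows "hessian G f u v w = dird v E u \<bullet> dird w \<nu> u"
proof -
  have chr: "(\<Sum>c\<in>UNIV. christoffel G u c i j * partial c f u) =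
      dird (axis i 1) (dird (axis j 1) \<nu>) u \<bullet> E u" for i j
  proof -
    have "(\<Sum>c\<in>UNIV. christoffel G u c i j * partial c f u) =
      (\<Sum>c\<in>UNIV. \<Sum>l\<in>UNIV. Gi u $ l $ c * dird (axis c 1) f u *
        (dird (axis i 1) (dird (axis j 1) \<nu>) u \<bullet> dird (axis l 1) \<nu> u))"
      by (simp add: christoffel_nu[OF u] partial_def sum_distrib_left mult_ac Gi_sym[OF u, of _ l for l])
    also have "\<dots> = (\<Sum>l\<in>UNIV. \<Sum>c\<in>UNIV. Gi u $ l $ c * dird (axis c 1) f u *
        (dird (axis i 1) (dird (axis j 1) \<nu>) u \<bullet> dird (axis l 1) \<nu> u))"
      by (rule sum.swap)
    also have "\<dots> = dird (axis i 1) (dird (axis j 1) \<nu>) u \<bullet> E u"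
      by (simp add: E_def gradient_component inner_sum_right sum_distrib_right)
    finally show ?thesis .
  qed
  have "hessian G f u v w = (\<Sum>i\<in>UNIV. \<Sum>j\<in>UNIV. v $ i * w $ j *
      (dird (axis i 1) (dird (axis j 1) f) u - dird (axis i 1) (dird (axis j 1) \<nu>) u \<bullet> E u))"
    unfolding hessian_def chr by (simp add: partial_def[abs_def])
  also have "\<dots> = dird v (dird w f) u - dird v (dird w \<nu>) u \<bullet> E u"
    by (simp add: dird2_axis_expand[OF f_smooth u, of w v] dird2_axis_expand[OF nu_smooth u, of w v]
        inner_sum_left right_diff_distrib sum_subtractf)
  finally show ?thesis by (simp add: dE_dnu[OF u])
qed

section \<open>The equation for the Laguerre tensor\<close>

definition \<sigma> :: "real^'n \<Rightarrow> real" where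
  "\<sigma> u = lam * (rho k u * rho k u) - (1/2) * (E u \<bullet> E u - 1)"

lemma sigma_smooth: "smooth_on \<sigma> D"
  unfolding \<sigma>_def[abs_def]
  by (intro smooth_on_diff smooth_on_mult smooth_on_inner smooth_on_const D rho_smooth E_smooth)

text \<open>The tensor equation solved for the Hessian: \<sigma> collects the terms proportional to
  the metric. Its Kronecker delta becomes \<open>d\<nu> \<bullet> d\<nu>\<close> because the vectors
  \<open>radius k i u *\<^sub>R e i u\<close> are orthonormal for the third form.\<close>

lemma dE_dnu_e:
  assumes u: "u \<in> D"
  shows "dird (e i u) E u \<bullet> dird (e j u) \<nu> u =
    dird (e i u) f u * dird (e j u) f u + \<sigma> u * (dird (e i u) \<nu> u \<bullet> dird (e j u) \<nu> u)"
proof -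
  let ?h = "dird (e i u) E u \<bullet> dird (e j u) \<nu> u" and ?d = "dird (e i u) f u * dird (e j u) f u"
    and ?\<delta> = "if i = j then 1 else (0::real)"
  have "hessian G f u (radius k i u *\<^sub>R e i u) (radius k j u *\<^sub>R e j u) = radius k i u * radius k j u * ?h"
    by (simp add: hessian_E[OF u] linear_cmul[OF linear_dird[OF _ u]] E_smooth nu_smooth)
  then have "(1 / (rho k u)\<^sup>2) * (radius k i u * radius k j u * (?h - ?d) + (1/2) * (E u \<bullet> E u - 1) * ?\<delta>) = lam * ?\<delta>"
    using tens[OF u, of i j] by (simp add: laguerre_tensor_coeff_def gradient_norm[OF u] algebra_simps)
  then have "radius k i u * radius k j u * (?h - ?d) = \<sigma> u * ?\<delta>"
    using rho_nz[OF u] by (simp add: field_simps \<sigma>_def power2_eq_square split: if_splits)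
  then have "?h - ?d = k i u * k j u * (\<sigma> u * ?\<delta>)"
    using k_nz[OF u] by (simp add: radius_def field_simps split: if_splits)
  then show ?thesis
    by (cases "i = j"; simp add: dnu_e[OF u] t_orth[OF u] algebra_simps)
qed

lemma tangent_ext:
  assumes u: "u \<in> D" and "x \<bullet> \<nu> u = z \<bullet> \<nu> u" "\<And>i. x \<bullet> dird (e i u) \<nu> u = z \<bullet> dird (e i u) \<nu> u"
  shows "x = z"
proof -
  have "x \<bullet> t i u = z \<bullet> t i u" for i
    using assms(3)[of i] by (simp add: dy_e[OF u])
  with assms(2) orthonormal_frame_expand[OF codim nu_norm[OF u] nu_t[OF u] t_orth[OF u], of z]
  show ?thesis
    by (subst orthonormal_frame_expand[OF codim nu_norm[OF u] nu_t[OF u] t_orth[OF u], of x]) simp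
qed

text \<open>The tensor equation gives the tangential components of \<open>dE\<close>;
  differentiating \<open>E \<bullet> \<nu> = 0\<close> gives the normal one.\<close>

lemma dE:
  assumes u: "u \<in> D"
  shows "dird w E u = \<sigma> u *\<^sub>R dird w \<nu> u + dird w f u *\<^sub>R (E u - \<nu> u)"
proof (rule frame_ext[OF u, where L = "\<lambda>w. dird w E u"])
  show "linear (\<lambda>w. dird w E u)"
    by (rule linear_dird[OF E_smooth u])
  show "linear (\<lambda>w. \<sigma> u *\<^sub>R dird w \<nu> u + dird w f u *\<^sub>R (E u - \<nu> u))"
    by (intro linear_compose_add linear_componentI[OF linear_dird[OF nu_smooth u]]
      linear_componentI[OF linear_dird[OF f_smooth u]] bounded_linear_scaleR_right bounded_linear_scaleR_left)
  fix i
  have nn: "\<nu> u \<bullet> \<nu> u = 1" using nu_norm[OF u] by (simp add: norm_eq_1)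
  have dn: "dird (e i u) \<nu> u \<bullet> \<nu> u = 0" using nu_dnu[OF u] by (simp add: inner_commute)
  show "dird (e i u) E u = \<sigma> u *\<^sub>R dird (e i u) \<nu> u + dird (e i u) f u *\<^sub>R (E u - \<nu> u)"
  proof (rule tangent_ext[OF u])
    show "dird (e i u) E u \<bullet> \<nu> u = (\<sigma> u *\<^sub>R dird (e i u) \<nu> u + dird (e i u) f u *\<^sub>R (E u - \<nu> u)) \<bullet> \<nu> u"
      by (simp add: dE_nu[OF u] inner_add_left inner_diff_left E_nu[OF u] nn dn)
    show "dird (e i u) E u \<bullet> dird (e j u) \<nu> u =
        (\<sigma> u *\<^sub>R dird (e i u) \<nu> u + dird (e i u) f u *\<^sub>R (E u - \<nu> u)) \<bullet> dird (e j u) \<nu> u" for j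
      by (simp add: dE_dnu_e[OF u] inner_add_left inner_diff_left E_dnu[OF u] nu_dnu[OF u])
  qed
qed

text \<open>The term \<open>2 \<lambda> \<rho>\<^sup>2\<close> from differentiating \<rho> equals
  \<open>2 \<sigma> + E \<bullet> E - 1\<close>, which leaves a multiple of \<open>df\<close>. This
  is what makes \<open>dZ\<close> proportional to \<open>Z\<close>.\<close>

lemma dsigma:
  assumes u: "u \<in> D"
  shows "dird w \<sigma> u = (\<sigma> u - 1) * dird w f u"
proof -
  have "dird w \<sigma> u = lam * (2 * (rho k u * dird w (rho k) u)) - E u \<bullet> dird w E u"
    unfolding \<sigma>_def[abs_def]
    by (simp only: dird_diff dird_mult dird_inner differentiableD[OF _ u] smooth_on_diff smooth_on_mult smooth_on_inner
        smooth_on_const D rho_smooth E_smooth frechet_derivative_const inner_commute[of "dird w E u"]) simp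
  also have "E u \<bullet> dird w E u = (\<sigma> u + E u \<bullet> E u) * dird w f u"
    by (simp add: dE[OF u] inner_add_right inner_diff_right E_dnu[OF u] E_nu[OF u] algebra_simps)
  finally show ?thesis
    by (simp add: drho[OF u] \<sigma>_def[of u] algebra_simps)
qed

section \<open>A moving frame of the Lorentz space\<close>

definition N :: "real^'n \<Rightarrow> (real^'m) \<times> real" where "N u = (\<nu> u, 1)"

definition Z :: "real^'n \<Rightarrow> (real^'m) \<times> real" where "Z u = \<sigma> u *\<^sub>R N u - (E u, 1)"

text \<open>The tangent vector \<open>t i\<close>, corrected by the multiple of the null vector
  \<open>N\<close> that makes it orthogonal to \<open>Z\<close>; inner products among the
  \<open>Q i\<close> are unaffected.\<close>

definition Q :: "'n \<Rightarrow> real^'n \<Rightarrow> (real^'m) \<times> real" where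
  "Q i u = (t i u, 0) + (E u \<bullet> t i u) *\<^sub>R N u"

lemma N_smooth: "smooth_on N D"
  unfolding N_def[abs_def] by (intro smooth_on_Pair smooth_on_const D nu_smooth)

lemma Z_smooth: "smooth_on Z D"
  unfolding Z_def[abs_def]
  by (intro smooth_on_diff smooth_on_scaleR smooth_on_Pair smooth_on_const D N_smooth E_smooth sigma_smooth)

lemma dN: "u \<in> D \<Longrightarrow> dird w N u = (dird w \<nu> u, 0)"
  unfolding N_def[abs_def] by (simp add: dird_Pair differentiableD nu_smooth)

text \<open>\<open>exp (- f) * Z\<close> is constant: up to the factor \<open>\<rho>\<close>, \<open>Z\<close> is the fixed vector \<open>(b, - a)\<close> with
  \<open>1 / \<rho> = a + b \<bullet> \<nu>\<close>, whose Lorentz square is \<open>2 * lam\<close>.\<close>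

lemma dZ:
  assumes u: "u \<in> D"
  shows "dird w Z u = dird w f u *\<^sub>R Z u"
proof -
  have "dird w Z u = \<sigma> u *\<^sub>R dird w N u + dird w \<sigma> u *\<^sub>R N u - (dird w E u, 0)"
    unfolding Z_def[abs_def]
    by (simp add: dird_diff dird_scaleR dird_Pair differentiableD[OF _ u] smooth_on_scaleR smooth_on_Pair
        smooth_on_const D N_smooth E_smooth sigma_smooth)
  then show ?thesis
    by (simp add: dN[OF u] dE[OF u] dsigma[OF u] Z_def N_def algebra_simps)
qed

lemma Q_Q:
  assumes u: "u \<in> D"
  shows "lorentz (Q i u) (Q j u) = (if i = j then 1 else 0)"
    and "lorentz (Q i u) (N u) = 0"
    and "lorentz (Q i u) (Z u) = 0"
proof -
  have nn: "\<nu> u \<bullet> \<nu> u = 1" using nu_norm[OF u] by (simp add: norm_eq_1)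
  have tn: "t i u \<bullet> \<nu> u = 0" for i using nu_t[OF u] by (simp add: inner_commute)
  have nE: "\<nu> u \<bullet> E u = 0" using E_nu[OF u] by (simp add: inner_commute)
  have tE: "t i u \<bullet> E u = E u \<bullet> t i u" for i by (rule inner_commute)
  note simps = nn nu_t[OF u] t_orth[OF u] E_nu[OF u] tn nE tE
  show "lorentz (Q i u) (Q j u) = (if i = j then 1 else 0)" "lorentz (Q i u) (N u) = 0"
    by (simp_all add: lorentz_def Q_def N_def inner_add_left inner_add_right simps)
  show "lorentz (Q i u) (Z u) = 0"
    by (simp add: lorentz_def Q_def Z_def N_def inner_add_left inner_diff_right simps) (simp add: algebra_simps)
qed

text \<open>In directions with \<open>b i = s\<close> this equals \<open>- radius k i\<close>, yet
  it is built only from smooth functions.\<close>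

definition \<alpha> :: "real \<Rightarrow> real^'n \<Rightarrow> real" where "\<alpha> s u = rho k u * s - mean_radius k u"

text \<open>\<open>C s\<close> is the curvature sphere of the principal directions with \<open>b i = s\<close>.\<close>

definition C :: "real \<Rightarrow> real^'n \<Rightarrow> (real^'m) \<times> real" where
  "C s u = (y u, 0) - \<alpha> s u *\<^sub>R N u"

lemma alpha_smooth: "smooth_on (\<alpha> s) D"
  unfolding \<alpha>_def[abs_def] by (intro smooth_on_diff smooth_on_mult smooth_on_const D rho_smooth mean_smooth)

lemma C_smooth: "smooth_on (C s) D"
  unfolding C_def[abs_def]
  by (intro smooth_on_diff smooth_on_scaleR smooth_on_Pair smooth_on_const D y_smooth alpha_smooth N_smooth)

text \<open>The vanishing Laguerre form enters through \<open>dmean_e\<close>: it makes the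
  \<open>N\<close> part of the derivative exactly the correction contained in \<open>Q i\<close>.
  For \<open>b i = s\<close> the derivative is zero.\<close>

lemma dC_e:
  assumes u: "u \<in> D"
  shows "dird (e i u) (C s) u = - (rho k u * (b i u - s) * k i u) *\<^sub>R Q i u"
proof -
  let ?v = "e i u"
  have da: "dird ?v (\<alpha> s) u = rho k u * (s - b i u) * dird ?v f u"
    unfolding \<alpha>_def[abs_def]
    by (simp add: dird_diff dird_mult differentiableD[OF _ u] smooth_on_mult smooth_on_const D rho_smooth mean_smooth
        drho[OF u] dmean_e[OF u] algebra_simps)
  have df: "dird ?v f u = - k i u * (E u \<bullet> t i u)"
    using E_dnu[OF u, of ?v] by (simp add: dnu_e[OF u])
  have "dird ?v (C s) u = (t i u, 0) - (\<alpha> s u *\<^sub>R (dird ?v \<nu> u, 0) + dird ?v (\<alpha> s) u *\<^sub>R N u)"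
    unfolding C_def[abs_def] t_def
    by (simp add: dird_diff dird_scaleR dird_Pair differentiableD[OF _ u] smooth_on_scaleR smooth_on_Pair
        smooth_on_const D y_smooth alpha_smooth N_smooth dN[OF u])
  also have "\<dots> = (1 + \<alpha> s u * k i u) *\<^sub>R (t i u, 0) + (rho k u * (s - b i u) * k i u * (E u \<bullet> t i u)) *\<^sub>R N u"
    by (simp add: dnu_e[OF u] da df N_def algebra_simps)
  also have "1 + \<alpha> s u * k i u = rho k u * (s - b i u) * k i u"
    using rho_nz[OF u] k_nz[OF u] by (simp add: \<alpha>_def b_def radius_def field_simps)
  finally show ?thesis
    by (simp add: Q_def scaleR_add_right) (simp add: algebra_simps)
qed

lemma b_cases: "u \<in> D \<Longrightarrow> b i u = p \<or> b i u = q"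
  using b_values by blast

lemma linear_lorentz_dC: "u \<in> D \<Longrightarrow> linear (\<lambda>v. lorentz (dird v (C s) u) X)"
  by (rule linear_componentI[OF linear_dird[OF C_smooth] lorentz.bounded_linear_left])

text \<open>Each principal direction is killed by \<open>dC q\<close> or by \<open>dC p\<close>, so
  the two images are spanned by disjoint sets of the orthonormal \<open>Q i\<close>.\<close>

lemma dC_orth:
  assumes u: "u \<in> D"
  shows "lorentz (dird v (C q) u) (dird w (C p) u) = 0"
proof -
  have "lorentz (dird (e i u) (C q) u) (dird (e j u) (C p) u) = 0" for i j
    using b_cases[OF u, of i] by (auto simp: dC_e[OF u] lorentz.scaleR_left lorentz.scaleR_right lorentz.minus_left lorentz.minus_right Q_Q[OF u])
  then have "lorentz (dird v (C q) u) (dird (e j u) (C p) u) = 0" for j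
    by (rule frame_ext[OF u linear_lorentz_dC[OF u] linear_zero])
  then have "lorentz (dird (e j u) (C p) u) (dird v (C q) u) = 0" for j
    by (simp only: lorentz_commute[of _ "dird v (C q) u"])
  then have "lorentz (dird w (C p) u) (dird v (C q) u) = 0"
    by (rule frame_ext[OF u linear_lorentz_dC[OF u] linear_zero])
  then show ?thesis
    by (simp only: lorentz_commute[of _ "dird w (C p) u"])
qed

lemma dC_N:
  assumes u: "u \<in> D"
  shows "lorentz (dird v (C s) u) (N u) = 0"
  by (rule frame_ext[OF u linear_lorentz_dC[OF u] linear_zero])
    (simp add: dC_e[OF u] lorentz.scaleR_left lorentz.minus_left Q_Q[OF u])

lemma dC_Z:
  assumes u: "u \<in> D"
  shows "lorentz (dird v (C s) u) (Z u) = 0"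
  by (rule frame_ext[OF u linear_lorentz_dC[OF u] linear_zero])
    (simp add: dC_e[OF u] lorentz.scaleR_left lorentz.minus_left Q_Q[OF u])

section \<open>Second derivatives of the curvature spheres\<close>

lemma lorentz_zero_deriv:
  assumes "\<And>u. u \<in> D \<Longrightarrow> lorentz (X u) (Y u) = 0" "smooth_on X D" "smooth_on Y D" and u: "u \<in> D"
  shows "lorentz (dird w X u) (Y u) = - lorentz (X u) (dird w Y u)"
proof -
  have "dird w (\<lambda>u. lorentz (X u) (Y u)) u = dird w (\<lambda>u. 0) u"
    by (rule dird_cong[OF D u]) (simp_all add: assms differentiableD[OF lorentz.smooth_on[OF D] u])
  then show ?thesis
    by (simp add: dird_lorentz differentiableD[OF _ u] assms)
qed

text \<open>Differentiating \<open>dC_Z\<close> produces only a term with \<open>dZ\<close>, which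
  is a multiple of \<open>Z\<close>.\<close>

lemma ddC_Z:
  assumes u: "u \<in> D"
  shows "lorentz (dird w (dird v (C s)) u) (Z u) = 0"
proof -
  have "lorentz (dird w (dird v (C s)) u) (Z u) = - lorentz (dird v (C s) u) (dird w Z u)"
    by (rule lorentz_zero_deriv[OF dC_Z smooth_on_dird[OF C_smooth] Z_smooth u])
  then show ?thesis
    by (simp add: dZ[OF u] lorentz.scaleR_right dC_Z[OF u])
qed

text \<open>The vectors \<open>e i u\<close> and \<open>e j u\<close> are frozen at the point
  \<open>u\<close>, so no derivative of the frame occurs; all comes from \<open>dN\<close>.\<close>

lemma ddC_N:
  assumes u: "u \<in> D"
  shows "lorentz (dird (e j u) (dird (e i u) (C s)) u) (N u) =
    (if i = j then - rho k u * (b i u - s) * (k i u)\<^sup>2 else 0)"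
proof -
  have "lorentz (dird (e j u) (dird (e i u) (C s)) u) (N u) = - lorentz (dird (e i u) (C s) u) (dird (e j u) N u)"
    by (rule lorentz_zero_deriv[OF dC_N smooth_on_dird[OF C_smooth] N_smooth u])
  moreover have "lorentz (Q i u) (dird (e j u) \<nu> u, 0) = t i u \<bullet> dird (e j u) \<nu> u"
    by (simp add: lorentz_def Q_def N_def inner_add_left nu_dnu[OF u])
  moreover have "t i u \<bullet> dird (e j u) \<nu> u = (if i = j then - k i u else 0)"
    by (simp add: dnu_e[OF u] t_orth[OF u])
  ultimately show ?thesis
    by (simp add: dN[OF u] dC_e[OF u] lorentz.scaleR_left lorentz.minus_left power2_eq_square)
qed

text \<open>On eigenvectors with \<open>b i = s\<close> both sides vanish; on the others
  \<open>S\<close> has the eigenvalue \<open>\<rho> s'\<close>. Unlike an identity for single frame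
  vectors, this one can be differentiated.\<close>

lemma dC_S:
  assumes u: "u \<in> D" and s: "s = q \<and> s' = p \<or> s = p \<and> s' = q"
  shows "dird (S u *v v) (C s) u = (rho k u * s') *\<^sub>R dird v (C s) u"
proof (rule frame_ext[OF u])
  show "linear (\<lambda>v. dird (S u *v v) (C s) u)"
    using linear_compose[OF matrix_vector_mul_linear linear_dird[OF C_smooth u]] by (simp add: o_def)
  show "linear (\<lambda>v. (rho k u * s') *\<^sub>R dird v (C s) u)"
    by (rule linear_componentI[OF linear_dird[OF C_smooth u] bounded_linear_scaleR_right])
  fix i
  have "S u *v e i u = (rho k u * b i u) *\<^sub>R e i u"
    using rho_nz[OF u] by (simp add: S_e[OF u] b_def)
  then have "dird (S u *v e i u) (C s) u = (rho k u * b i u) *\<^sub>R dird (e i u) (C s) u"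
    by (simp add: linear_cmul[OF linear_dird[OF C_smooth u]])
  then show "dird (S u *v e i u) (C s) u = (rho k u * s') *\<^sub>R dird (e i u) (C s) u"
    using b_cases[OF u, of i] s by (auto simp: dC_e[OF u])
qed

lemma ddC_linear:
  assumes u: "u \<in> D"
  shows "linear (\<lambda>v. dird w (dird v (C s)) u)"
  by (subst dird_commute'[OF C_smooth u]) (rule linear_dird[OF smooth_on_dird[OF C_smooth] u])

text \<open>Differentiate \<open>dC_S\<close>. The terms in which \<open>S\<close> or \<rho> is
  differentiated contain only first derivatives of \<open>C q\<close>, which are orthogonal to
  \<open>dC p\<close>.\<close>

lemma ddC_S:
  assumes u: "u \<in> D"
  shows "lorentz (dird w (dird (S u *v v) (C q)) u) (dird z (C p) u) =
    rho k u * p * lorentz (dird w (dird v (C q)) u) (dird z (C p) u)"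
proof -
  let ?X = "dird z (C p) u"
  have Ssm: "smooth_on (\<lambda>u. (S u *v v) $ l) D" for l
    unfolding matrix_vector_mult_def by (simp add: smooth_on_sum smooth_on_mult smooth_on_const D S_smooth)
  have Csm: "smooth_on (dird w (C q)) D" for w by (rule smooth_on_dird[OF C_smooth])
  \<comment> \<open>Since \<open>S u *v v\<close> varies with \<open>u\<close>, it is expanded in
    the fixed coordinate directions before the product rule is applied.\<close>
  have "dird w (\<lambda>u. \<Sum>l\<in>UNIV. (S u *v v) $ l *\<^sub>R dird (axis l 1) (C q) u) u =
      dird w (\<lambda>u. (rho k u * p) *\<^sub>R dird v (C q) u) u"
  proof (rule dird_cong[OF D u])
    show "(\<Sum>l\<in>UNIV. (S u *v v) $ l *\<^sub>R dird (axis l 1) (C q) u) = (rho k u * p) *\<^sub>R dird v (C q) u"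
      if "u \<in> D" for u
      using dC_S[OF that, of q p v] dird_axis_expand[OF differentiableD[OF C_smooth that], of q "S u *v v"] by simp
    show "(\<lambda>u. \<Sum>l\<in>UNIV. (S u *v v) $ l *\<^sub>R dird (axis l 1) (C q) u) differentiable (at u)"
      by (intro differentiableD[OF _ u] smooth_on_sum smooth_on_scaleR D Ssm Csm)
  qed
  moreover have "dird w (\<lambda>u. \<Sum>l\<in>UNIV. (S u *v v) $ l *\<^sub>R dird (axis l 1) (C q) u) u =
      (\<Sum>l\<in>UNIV. (S u *v v) $ l *\<^sub>R dird w (dird (axis l 1) (C q)) u + dird w (\<lambda>u. (S u *v v) $ l) u *\<^sub>R dird (axis l 1) (C q) u)"
    by (simp add: dird_sum dird_scaleR differentiableD[OF _ u] smooth_on_scaleR D Ssm Csm)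
  moreover have "dird w (\<lambda>u. (rho k u * p) *\<^sub>R dird v (C q) u) u =
      (rho k u * p) *\<^sub>R dird w (dird v (C q)) u + dird w (\<lambda>u. rho k u * p) u *\<^sub>R dird v (C q) u"
    by (simp add: dird_scaleR differentiableD[OF _ u] Csm smooth_on_mult smooth_on_const D rho_smooth)
  ultimately have "lorentz (\<Sum>l\<in>UNIV. (S u *v v) $ l *\<^sub>R dird w (dird (axis l 1) (C q)) u
        + dird w (\<lambda>u. (S u *v v) $ l) u *\<^sub>R dird (axis l 1) (C q) u) ?X =
      lorentz ((rho k u * p) *\<^sub>R dird w (dird v (C q)) u + dird w (\<lambda>u. rho k u * p) u *\<^sub>R dird v (C q) u) ?X"
    by simp
  then have "lorentz (\<Sum>l\<in>UNIV. (S u *v v) $ l *\<^sub>R dird w (dird (axis l 1) (C q)) u) ?X =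
      rho k u * p * lorentz (dird w (dird v (C q)) u) ?X"
    by (simp add: lorentz.add_left lorentz.scaleR_left lorentz.sum_left dC_orth[OF u])
  then show ?thesis
    using linear_axis_expand[OF ddC_linear[OF u], of q "S u *v v" w] by simp
qed

text \<open>The trilinear form is symmetric in its first two slots by Schwarz and in its outer two
  by differentiating the orthogonality of the two families; \<open>S\<close> acts in the
  last two slots by different scalars, so the form vanishes.\<close>

lemma ddC_orth:
  assumes u: "u \<in> D"
  shows "lorentz (dird w (dird v (C q)) u) (dird z (C p) u) = 0"
proof -
  let ?T = "\<lambda>w v z. lorentz (dird w (dird v (C q)) u) (dird z (C p) u)"
  have 1: "?T w v z = ?T v w z" for w v z
    by (subst dird_commute'[OF C_smooth u]) simp
  have d: "?T w v z = - lorentz (dird v (C q) u) (dird w (dird z (C p)) u)" for w v z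
    by (rule lorentz_zero_deriv[OF dC_orth smooth_on_dird[OF C_smooth] smooth_on_dird[OF C_smooth] u])
  have 2: "?T w v z = ?T z v w" for w v z
    unfolding d by (subst dird_commute'[OF C_smooth u]) simp
  have "rho k u * p * ?T w v z = ?T w (S u *v v) z"
    by (simp add: ddC_S[OF u])
  also have "\<dots> = ?T w z (S u *v v)"
    using 1 2 by metis
  also have "\<dots> = rho k u * q * ?T w z v"
    by (simp add: dC_S[OF u, of p q] lorentz.scaleR_right)
  also have "\<dots> = rho k u * q * ?T w v z"
    using 1 2 by metis
  finally show ?thesis
    using rho_nz[OF u] pq by simp
qed

lemma ddC_orth':
  assumes u: "u \<in> D"
  shows "lorentz (dird v (C q) u) (dird w (dird z (C p)) u) = 0"
proof -
  have "lorentz (dird w (dird v (C q)) u) (dird z (C p) u) =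
      - lorentz (dird v (C q) u) (dird w (dird z (C p)) u)"
    by (rule lorentz_zero_deriv[OF dC_orth smooth_on_dird[OF C_smooth] smooth_on_dird[OF C_smooth] u])
  then show ?thesis by (simp add: ddC_orth[OF u])
qed

text \<open>Differentiating \<open>ddC_orth\<close> turns each side into minus a third derivative of
  \<open>C q\<close> paired with \<open>dC p\<close>, and third derivatives commute.\<close>

lemma ddC_ddC:
  assumes u: "u \<in> D"
  shows "lorentz (dird c (dird v (C q)) u) (dird w (dird z (C p)) u) =
    lorentz (dird w (dird v (C q)) u) (dird c (dird z (C p)) u)"
proof -
  have "lorentz (dird w (dird c (dird v (C q))) u) (dird z (C p) u) =
      - lorentz (dird c (dird v (C q)) u) (dird w (dird z (C p)) u)" for w c
    by (rule lorentz_zero_deriv[OF ddC_orth smooth_on_dird[OF smooth_on_dird[OF C_smooth]] smooth_on_dird[OF C_smooth] u])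
  from this[of w c] this[of c w] show ?thesis
    using dird_commute'[OF smooth_on_dird[OF C_smooth[of q], of v] u, of w c] by simp
qed

text \<open>In the basis \<open>Q i\<close>, \<open>N\<close>, \<open>Z\<close> the \<open>Q\<close>
  terms vanish by orthogonality and the \<open>Z\<close> terms by \<open>ddC_Z\<close>. Only the
  product of the \<open>N\<close> pairings remains, with coefficient minus the Lorentz square of
  \<open>Z\<close>.\<close>

lemma lorentz_ddC:
  assumes u: "u \<in> D"
  shows "lorentz (dird c (dird v (C q)) u) (dird w (dird z (C p)) u) =
    - (2 * lam * (rho k u)\<^sup>2) * (lorentz (dird c (dird v (C q)) u) (N u) * lorentz (dird w (dird z (C p)) u) (N u))"
    (is "lorentz ?X ?Y = _")
proof -
  have "lorentz ?X (Q i u) * lorentz ?Y (Q i u) = 0" for i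
  proof (cases "b i u = p")
    case True
    \<comment> \<open>For \<open>b i = p\<close> the vector \<open>Q i\<close> is a nonzero multiple
      of a derivative of \<open>C q\<close>, hence orthogonal to second derivatives of
      \<open>C p\<close>; the other case is symmetric.\<close>
    then have "lorentz (- (rho k u * (p - q) * k i u) *\<^sub>R Q i u) ?Y = 0"
      using ddC_orth'[OF u, of "e i u" z w] by (simp add: dC_e[OF u])
    then show ?thesis
      using rho_nz[OF u] k_nz[OF u] pq
      by (simp add: lorentz.scaleR_left lorentz.minus_left lorentz_commute[of ?Y])
  next
    case False
    then have "b i u = q" using b_cases[OF u] by blast
    then have "lorentz ?X (- (rho k u * (q - p) * k i u) *\<^sub>R Q i u) = 0"
      using ddC_orth[OF u, of v c "e i u"] by (simp add: dC_e[OF u])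
    then show ?thesis
      using rho_nz[OF u] k_nz[OF u] pq by (simp add: lorentz.scaleR_right lorentz.minus_right)
  qed
  then have "(\<Sum>i\<in>UNIV. lorentz ?X (Q i u) * lorentz ?Y (Q i u)) = 0"
    by (simp only: sum.neutral_const)
  moreover have "2 * \<sigma> u + E u \<bullet> E u - 1 = 2 * lam * (rho k u)\<^sup>2"
    by (simp add: \<sigma>_def power2_eq_square)
  ultimately show ?thesis
    using lorentz_expand[OF codim nu_norm[OF u] nu_t[OF u] t_orth[OF u] E_nu[OF u] N_def Z_def Q_def,
        of ?X ?Y]
    by (simp add: ddC_Z[OF u])
qed

lemma lam_zero:
  assumes u: "u \<in> D"
  shows "lam = 0"
proof -
  obtain i j where i: "b i u = p" and j: "b j u = q"
    using b_values[OF u] by (metis insertCI rangeE)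
  then have ij: "i \<noteq> j" using pq by auto
  let ?v = "e i u" and ?w = "e j u"
  have "lorentz (dird ?v (dird ?v (C q)) u) (dird ?w (dird ?w (C p)) u) =
      lorentz (dird ?w (dird ?v (C q)) u) (dird ?v (dird ?w (C p)) u)"
    by (rule ddC_ddC[OF u])
  \<comment> \<open>By \<open>ddC_N\<close> the mixed derivatives on the right have no pairing with
    \<open>N\<close>, as \<open>i \<noteq> j\<close>, while the pure ones on the left give the two
    nonzero factors.\<close>
  then have "lam * (rho k u * (p - q) * (k i u)\<^sup>2) * (rho k u * (q - p) * (k j u)\<^sup>2) = 0"
    using ij i j rho_nz[OF u] unfolding lorentz_ddC[OF u] by (simp add: ddC_N[OF u])
  then show ?thesis
    using rho_nz[OF u] k_nz[OF u] pq by simp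
qed

end

lemma (in two_curvature_hypersurface) lam_eq_zero:
  assumes "u \<in> D"
  shows "lam = 0"
proof -
  obtain p q where pq: "p > q" "\<And>u. u \<in> D \<Longrightarrow> range (\<lambda>i. b i u) = {p, q}"
    using two_constant_values by metis
  interpret two_valued_hypersurface D y \<nu> e k lam p q
    using pq by unfold_locales
  show ?thesis by (rule lam_zero[OF assms])
qed

section \<open>Principal curvatures in different charts\<close>

text \<open>Compare coefficients in the frame: a direction with curvature \<kappa> satisfies
  \<open>c j * k j u = \<kappa> * c j\<close> for all \<open>j\<close>, and some \<open>c j\<close>
  is nonzero.\<close>

lemma principal_curvature_of_frame:
  assumes hyp: "local_hypersurface D y \<nu>" and frame: "principal_frame D y \<nu> e k" and u: "u \<in> D"
  shows "(\<exists>v. principal_direction y \<nu> u \<kappa> v) \<longleftrightarrow> (\<exists>i. \<kappa> = k i u)"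
proof
  assume "\<exists>v. principal_direction y \<nu> u \<kappa> v"
  then obtain v where v: "v \<noteq> 0" "dird v \<nu> u = - \<kappa> *\<^sub>R dird v y u"
    by (auto simp: principal_direction_def)
  have ly: "linear (\<lambda>v. dird v y u)" and ln: "linear (\<lambda>v. dird v \<nu> u)"
    using hyp u by (auto simp: local_hypersurface_def intro: smooth_on_linear_dird)
  have orth: "dird (e i u) y u \<bullet> dird (e j u) y u = (if i = j then 1 else 0)"
    and dn: "dird (e i u) \<nu> u = - k i u *\<^sub>R dird (e i u) y u" for i j
    using frame u by (auto simp: principal_frame_def principal_direction_def)
  obtain c where c: "v = (\<Sum>i\<in>UNIV. c i *\<^sub>R e i u)"
    using basis_coordinates[OF orthonormal_image_basis[OF ly orth]] .
  have "c j * k j u = \<kappa> * c j" for j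
  proof -
    have "dird v \<nu> u \<bullet> dird (e j u) y u = - (c j * k j u)"
      by (simp add: c linear_sum[OF ln] linear_cmul[OF ln] dn inner_sum_left orth sum_negf
          if_distrib cong: if_cong)
    moreover have "dird v y u \<bullet> dird (e j u) y u = c j"
      by (simp add: c linear_sum[OF ly] linear_cmul[OF ly] inner_sum_left orth if_distrib cong: if_cong)
    ultimately show ?thesis using v(2) by auto
  qed
  moreover have "\<exists>j. c j \<noteq> 0"
    using v(1) c by (metis (no_types, lifting) scaleR_zero_left sum.neutral)
  ultimately show "\<exists>i. \<kappa> = k i u"
    by (metis mult.commute mult_right_cancel)
qed (use frame u in \<open>auto simp: principal_frame_def\<close>)

lemma chart_inj: "smooth_manifold M A \<Longrightarrow> c \<in> A \<Longrightarrow> p \<in> fst c \<Longrightarrow> inv_into (fst c) (snd c) (snd c p) = p"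
  by (auto simp: smooth_manifold_def homeomorphism_def)

lemma chart_open_image:
  assumes "smooth_manifold M A" "c \<in> A" "openin (top_of_set M) V"
  shows "open (snd c ` (fst c \<inter> V))"
proof -
  have c: "openin (top_of_set M) (fst c)" "open (chart_image c)"
    "homeomorphism (fst c) (chart_image c) (snd c) (inv_into (fst c) (snd c))"
    using assms(1,2) by (auto simp: smooth_manifold_def)
  have "openin (top_of_set (fst c)) (fst c \<inter> V)"
    by (rule openin_subset_trans[OF openin_Int[OF c(1) assms(3)] _ openin_imp_subset[OF c(1)]]) simp
  then have "openin (top_of_set (chart_image c)) (snd c ` (fst c \<inter> V))"
    by (rule homeomorphism_imp_open_map[OF c(3)])
  then show ?thesis using c(2) openin_open_eq by blast
qed

text \<open>The differential of the transition map carries \<open>v\<close> to a principal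
  direction: by the chain rule it relates the derivatives of \<open>x\<close> and of \<xi> in the
  same way.\<close>

lemma principal_direction_change_chart:
  fixes x \<xi> :: "'p::{t2_space, second_countable_topology} \<Rightarrow> real^'m::finite"
  assumes M: "smooth_manifold M A" and hyp: "immersed_hypersurface A x \<xi>"
    and c: "c \<in> A" "p \<in> fst c" and d: "d \<in> A" "p \<in> fst d"
    and v: "principal_direction (in_chart d x) (in_chart d \<xi>) (snd d p) \<kappa> v"
  shows "\<exists>w. principal_direction (in_chart c x) (in_chart c \<xi>) (snd c p) \<kappa> w"
proof -
  let ?T = "in_chart d (snd c)" and ?W = "snd d ` (fst d \<inter> fst c)" and ?w = "snd d p"
  have W: "open ?W" "?w \<in> ?W"
    using chart_open_image[OF M d(1), of "fst c"] M c d by (auto simp: smooth_manifold_def)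
  have "smooth_on ?T ?W" using M c(1) d(1) by (simp add: smooth_manifold_def)
  note T = smooth_on_has_derivative[OF this W(2)]
  have Tw: "?T ?w = snd c p" by (simp add: in_chart_def chart_inj[OF M d])
  have chain: "dird v (in_chart d z) ?w = dird (dird v ?T ?w) (in_chart c z) (snd c p)"
    if z: "smooth_on (in_chart c z) (chart_image c)" for z :: "'p \<Rightarrow> real^'m" and v
  proof -
    have "snd c p \<in> chart_image c" using c by (simp add: chart_image_def)
    from has_derivative_compose[OF T, unfolded Tw, OF smooth_on_has_derivative[OF z this]]
    have "((\<lambda>w. in_chart c z (?T w)) has_derivative (\<lambda>v. dird (dird v ?T ?w) (in_chart c z) (snd c p))) (at ?w)" .
    moreover have "in_chart c z (?T w) = in_chart d z w" if w: "w \<in> ?W" for w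
    proof -
      obtain p' where p': "w = snd d p'" "p' \<in> fst d" "p' \<in> fst c" using w by blast
      then show ?thesis by (simp add: in_chart_def chart_inj[OF M d(1)] chart_inj[OF M c(1)])
    qed
    ultimately have "(in_chart d z has_derivative (\<lambda>v. dird (dird v ?T ?w) (in_chart c z) (snd c p))) (at ?w)"
      by (rule has_derivative_transform_within_open[OF _ W])
    then show ?thesis by (rule dird_eqI)
  qed
  have hc: "local_hypersurface (chart_image c) (in_chart c x) (in_chart c \<xi>)"
    and hd: "local_hypersurface (chart_image d) (in_chart d x) (in_chart d \<xi>)"
    using hyp c d by (auto simp: immersed_hypersurface_def)
  have sc: "smooth_on (in_chart c x) (chart_image c)" "smooth_on (in_chart c \<xi>) (chart_image c)"
    using hc by (auto simp: local_hypersurface_def)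
  \<comment> \<open>Otherwise \<open>v\<close> would lie in the kernel of the differential of
    \<open>x\<close> in the chart \<open>d\<close>, which is injective.\<close>
  have "dird v ?T ?w \<noteq> 0"
  proof
    assume 0: "dird v ?T ?w = 0"
    have wd: "?w \<in> chart_image d" using d by (simp add: chart_image_def)
    have "linear (\<lambda>w. dird w (in_chart c x) (snd c p))"
      using smooth_on_linear_dird[OF sc(1)] c by (simp add: chart_image_def)
    then have "dird v (in_chart d x) ?w = 0"
      using chain[OF sc(1), of v] 0 linear_0 by simp
    moreover have "dird 0 (in_chart d x) ?w = 0"
      using hd wd linear_0[OF smooth_on_linear_dird] by (force simp: local_hypersurface_def)
    moreover have "inj (\<lambda>v. dird v (in_chart d x) ?w)"
      using hd wd by (simp add: local_hypersurface_def)
    ultimately have "v = 0" by (metis injD)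
    then show False using v by (simp add: principal_direction_def)
  qed
  then show ?thesis
    using v chain[OF sc(1), of v] chain[OF sc(2), of v] by (auto simp: principal_direction_def)
qed

lemma principal_curvatures_frame:
  assumes M: "smooth_manifold M A" and hyp: "immersed_hypersurface A x \<xi>"
    and c: "c \<in> A" "p \<in> fst c"
    and frame: "principal_frame (chart_image c) (in_chart c x) (in_chart c \<xi>) e k"
  shows "principal_curvatures A x \<xi> p = range (\<lambda>i. k i (snd c p))"
proof -
  have "\<kappa> \<in> principal_curvatures A x \<xi> p \<longleftrightarrow>
      (\<exists>v. principal_direction (in_chart c x) (in_chart c \<xi>) (snd c p) \<kappa> v)" for \<kappa>
    unfolding principal_curvatures_def
    using principal_direction_change_chart[OF M hyp c] c by blast
  moreover have "snd c p \<in> chart_image c" using c by (simp add: chart_image_def)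
  moreover have "local_hypersurface (chart_image c) (in_chart c x) (in_chart c \<xi>)"
    using hyp c by (simp add: immersed_hypersurface_def)
  ultimately show ?thesis
    using principal_curvature_of_frame[OF _ frame] by blast
qed

section \<open>From one chart to the whole manifold\<close>

theorem corollary5:
  fixes M :: "'p::{t2_space, second_countable_topology} set"
    and A :: "('p, 'n::finite) chart set"
    and x \<xi> :: "'p \<Rightarrow> real^'m::finite"
    and lam :: real
  assumes "CARD('n) \<ge> 3"
    and "CARD('m) = CARD('n) + 1"
    and "smooth_manifold M A"
    and "immersed_hypersurface A x \<xi>"
    and "L_isotropic A x \<xi> lam"
    and "lam > 0"
  shows "(\<forall>V m. openin (top_of_set M) V \<and> V \<noteq> {} \<and>
             (\<forall>p\<in>V. card {\<kappa> \<in> principal_curvatures A x \<xi> p. \<kappa> \<noteq> 0} = m) \<longrightarrow> m \<ge> 3) \<and>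
         M \<subseteq> closure {p \<in> M. card {\<kappa> \<in> principal_curvatures A x \<xi> p. \<kappa> \<noteq> 0} \<ge> 3}"
proof -
  let ?S = "{p \<in> M. card {\<kappa> \<in> principal_curvatures A x \<xi> p. \<kappa> \<noteq> 0} \<ge> 3}"
  have dense: "M \<subseteq> closure ?S"
  proof (rule subsetI, rule ccontr)
    fix p assume p: "p \<in> M" "p \<notin> closure ?S"
    obtain c where c: "c \<in> A" "p \<in> fst c"
      using assms(3) p(1) by (auto simp: smooth_manifold_def)
    let ?V = "M \<inter> - closure ?S" and ?y = "in_chart c x" and ?\<nu> = "in_chart c \<xi>"
    have "openin (top_of_set M) ?V" by (intro openin_open_Int open_Compl closed_closure)
    then have "open (snd c ` (fst c \<inter> ?V))" by (rule chart_open_image[OF assms(3) c(1)])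
    moreover have "snd c p \<in> snd c ` (fst c \<inter> ?V)" using p c by blast
    ultimately obtain r where r: "r > 0" "ball (snd c p) r \<subseteq> snd c ` (fst c \<inter> ?V)"
      using open_contains_ball by blast
    \<comment> \<open>A ball, so that the domain is connected; every point of it comes from a point
      outside the closure of \<open>?S\<close>.\<close>
    define D where "D = ball (snd c p) r"
    have D: "D \<subseteq> chart_image c" using r(2) by (auto simp: D_def chart_image_def)
    have "local_L_isotropic (chart_image c) ?y ?\<nu> lam"
      using assms(5) c(1) by (simp add: L_isotropic_def)
    then obtain e k where frame: "principal_frame (chart_image c) ?y ?\<nu> e k"
      and iso: "\<forall>u\<in>chart_image c. (\<forall>i. k i u \<noteq> 0) \<and> (\<exists>i j. k i u \<noteq> k j u) \<and>
          (\<forall>v. laguerre_form ?\<nu> e k u v = 0) \<and>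
          (\<forall>i j. laguerre_tensor_coeff ?\<nu> e k i j u = (if i = j then lam else 0))"
      unfolding local_L_isotropic_def by (elim exE conjE)
    have hyp: "local_hypersurface (chart_image c) ?y ?\<nu>"
      using assms(4) c by (simp add: immersed_hypersurface_def)
    have k0: "k i u \<noteq> 0" if "u \<in> D" for u i using iso that D by blast
    \<comment> \<open>Fewer than three curvatures because the point is not in \<open>?S\<close>,
      more than one because there are no umbilics.\<close>
    have two: "card (range (\<lambda>i. k i u)) = 2" if u: "u \<in> D" for u
    proof -
      obtain p' where p': "p' \<in> fst c" "p' \<in> M" "p' \<notin> closure ?S" "u = snd c p'"
        using u r(2) by (auto simp: D_def)
      have "p' \<notin> ?S" by (rule contra_subsetD[OF closure_subset p'(3)])
      moreover have "{\<kappa> \<in> principal_curvatures A x \<xi> p'. \<kappa> \<noteq> 0} = range (\<lambda>i. k i u)"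
        unfolding principal_curvatures_frame[OF assms(3,4) c(1) p'(1) frame] p'(4)[symmetric]
        using k0[OF u] by auto
      ultimately have "card (range (\<lambda>i. k i u)) < 3" using p'(2) by simp
      moreover obtain i j where "k i u \<noteq> k j u" using iso u D by blast
      then have "card {k i u, k j u} \<le> card (range (\<lambda>i. k i u))" by (intro card_mono) auto
      ultimately show ?thesis using \<open>k i u \<noteq> k j u\<close> by simp
    qed
    interpret two_curvature_hypersurface D ?y ?\<nu> e k lam
    proof
      show "local_hypersurface D ?y ?\<nu>"
        using hyp D unfolding local_hypersurface_def by (blast intro: smooth_on_subset)
      show "principal_frame D ?y ?\<nu> e k"
        using frame D unfolding principal_frame_def by blast
      show "open D" "connected D" by (simp_all add: D_def)
    qed (use assms(2) two iso D in blast)+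
    have "lam = 0" by (rule lam_eq_zero[of "snd c p"]) (simp add: D_def r(1))
    then show False using assms(6) by simp
  qed
  \<comment> \<open>A nonempty relatively open set meets the dense set \<open>?S\<close>, and at a
    common point the constant number \<open>m\<close> is at least three.\<close>
  have "m \<ge> 3" if V: "openin (top_of_set M) V" "V \<noteq> {}"
    "\<forall>p\<in>V. card {\<kappa> \<in> principal_curvatures A x \<xi> p. \<kappa> \<noteq> 0} = m" for V m
  proof -
    obtain W where W: "open W" "V = M \<inter> W" using V(1) by (auto simp: openin_open)
    obtain p where "p \<in> V" using V(2) by blast
    then have "W \<inter> closure ?S \<noteq> {}" using dense W(2) by blast
    then obtain p' where "p' \<in> W" "p' \<in> ?S" using open_Int_closure_eq_empty[OF W(1)] by blast
    then show ?thesis using V(3) W(2) by auto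
  qed
  then show ?thesis using dense by blast
qed

end
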